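(* Let $a\in\mathbb{R}$, $a\neq 0$, and consider the planar system $\dot x=y$, $\dot y=2axy$. In the chart $U_2$ of its Poincaré compactification the system is $$\dot u = v-2au^{2},\qquad \dot v = -2auv,$$ and the critical point $(u,v)=(0,0)$ of this system has one hyperbolic sector and one elliptic sector.
   Context: For a polynomial vector field $\dot x=P(x,y)$, $\dot y=Q(x,y)$ of degree $d$, its expression in the chart $U_2$ of the Poincaré compactification (coordinates $u=x/y$, $v=1/y$, with the points at infinity given by $v=0$) is $\dot u=v^{d}\left[P\left(\frac uv,\frac1v\right)-uQ\left(\frac uv,\frac1v\right)\right]$, $\dot v=-v^{d+1}Q\left(\frac uv,\frac1v\right)$. The local phase portrait of an isolated critical point is decomposed into sectors: hyperbolic (orbits enter and leave the neighbourhood without tending to the point, as at a saddle), elliptic (containing orbits that tend to the point both as $t\to+\infty$ and as $t\to-\infty$), and parabolic (orbits tend to the point in exactly one time direction). The statement counts the hyperbolic and elliptic sectors; parabolic sectors are not counted. *)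

theory Defs
  imports "HOL-Analysis.Analysis"
begin

section \<open>The chart \<open>U\<^sub>2\<close> of the Poincare compactification\<close>

definition poly2_degree_le :: "nat \<Rightarrow> (real \<Rightarrow> real \<Rightarrow> real) \<Rightarrow> bool" where
  "poly2_degree_le d f \<longleftrightarrow>
     (\<exists>k :: nat \<Rightarrow> nat \<Rightarrow> real. \<forall>x y. f x y = (\<Sum>i\<le>d. \<Sum>j\<le>d - i. k i j * x ^ i * y ^ j))"

text \<open>The degree of \<open>x' = P(x,y)\<close>, \<open>y' = Q(x,y)\<close>; only meaningful for polynomial \<open>P\<close>, \<open>Q\<close>.\<close>

definition field_degree :: "(real \<Rightarrow> real \<Rightarrow> real) \<Rightarrow> (real \<Rightarrow> real \<Rightarrow> real) \<Rightarrow> nat" where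
  "field_degree P Q = (LEAST d. poly2_degree_le d P \<and> poly2_degree_le d Q)"

definition U2_formula ::
  "(real \<Rightarrow> real \<Rightarrow> real) \<Rightarrow> (real \<Rightarrow> real \<Rightarrow> real) \<Rightarrow> real \<times> real \<Rightarrow> real \<times> real" where
  "U2_formula P Q = (\<lambda>(u, v). let d = field_degree P Q in
     (v ^ d * (P (u / v) (1 / v) - u * Q (u / v) (1 / v)),
      - (v ^ (d + 1)) * Q (u / v) (1 / v)))"

text \<open>The formula involves \<open>1/v\<close>, but for \<open>v \<noteq> 0\<close> it is a polynomial in \<open>(u, v)\<close>; at the points at
  infinity \<open>v = 0\<close> the chart expression is the continuous extension (and not the value that
  results from the convention \<open>1/0 = 0\<close>).\<close>

definition poincare_U2 ::
  "(real \<Rightarrow> real \<Rightarrow> real) \<Rightarrow> (real \<Rightarrow> real \<Rightarrow> real) \<Rightarrow> real \<times> real \<Rightarrow> real \<times> real" where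
  "poincare_U2 P Q = (\<lambda>z. if snd z \<noteq> 0 then U2_formula P Q z
                           else Lim (at z within {w. snd w \<noteq> 0}) (U2_formula P Q))"


section \<open>Orbits\<close>

text \<open>Vector fields are meant to be locally Lipschitz, so that the solution through a point is
  unique. Backward orbits of \<open>X\<close> are forward orbits of \<open>- X\<close>.\<close>

type_synonym vfield = "real \<times> real \<Rightarrow> real \<times> real"

definition solves :: "vfield \<Rightarrow> (real \<Rightarrow> real \<times> real) \<Rightarrow> real set \<Rightarrow> bool" where
  "solves X \<phi> I \<longleftrightarrow> (\<forall>t\<in>I. (\<phi> has_vector_derivative X (\<phi> t)) (at t within I))"

definition tends_to_pt :: "vfield \<Rightarrow> real \<times> real \<Rightarrow> real \<times> real \<Rightarrow> bool" where
  "tends_to_pt X q p \<longleftrightarrow> (\<exists>\<phi>. solves X \<phi> {0..} \<and> \<phi> 0 = q \<and> (\<phi> \<longlongrightarrow> p) at_top)"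

definition meets :: "vfield \<Rightarrow> real \<times> real \<Rightarrow> (real \<times> real) set \<Rightarrow> bool" where
  "meets X q A \<longleftrightarrow> (\<exists>\<phi> T. 0 \<le> T \<and> solves X \<phi> {0..T} \<and> \<phi> 0 = q \<and> \<phi> T \<in> A)"

definition homoclinic ::
  "vfield \<Rightarrow> real \<times> real \<Rightarrow> (real \<Rightarrow> real \<times> real) \<Rightarrow> bool" where
  "homoclinic X p \<phi> \<longleftrightarrow> solves X \<phi> UNIV \<and> (\<phi> \<longlongrightarrow> p) at_top \<and> (\<phi> \<longlongrightarrow> p) at_bot"


section \<open>Sectors\<close>

text \<open>Sectorial decomposition in the sense of Dumortier, Llibre and Artes (Qualitative Theory of
  Planar Differential Systems, Section 1.5). The neighbourhood of the critical point is the closed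
  disc bounded by a regular \<open>C\<^sup>1\<close> Jordan curve, given by a 1-periodic parametrization \<open>\<Gamma>\<close> of
  the whole real line, so that an arc of the boundary is the image of an interval.\<close>

definition jordan_C1 :: "(real \<Rightarrow> real \<times> real) \<Rightarrow> bool" where
  "jordan_C1 \<Gamma> \<longleftrightarrow> \<Gamma> C1_differentiable_on UNIV \<and> (\<forall>s. vector_derivative \<Gamma> (at s) \<noteq> 0) \<and>
     (\<forall>s. \<Gamma> (s + 1) = \<Gamma> s) \<and> inj_on \<Gamma> {0..<1}"

definition disc :: "(real \<Rightarrow> real \<times> real) \<Rightarrow> (real \<times> real) set" where
  "disc \<Gamma> = range \<Gamma> \<union> inside (range \<Gamma>)"

definition tangent_at :: "vfield \<Rightarrow> (real \<Rightarrow> real \<times> real) \<Rightarrow> real \<Rightarrow> bool" where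
  "tangent_at X \<Gamma> s \<longleftrightarrow> collinear {0, X (\<Gamma> s), vector_derivative \<Gamma> (at s)}"

definition inward :: "vfield \<Rightarrow> (real \<Rightarrow> real \<times> real) \<Rightarrow> real \<Rightarrow> bool" where
  "inward X \<Gamma> s \<longleftrightarrow> \<not> tangent_at X \<Gamma> s \<and>
     (\<exists>\<epsilon>>0. \<forall>t. 0 < t \<and> t < \<epsilon> \<longrightarrow> \<Gamma> s + t *\<^sub>R X (\<Gamma> s) \<in> inside (range \<Gamma>))"

abbreviation outward :: "vfield \<Rightarrow> (real \<Rightarrow> real \<times> real) \<Rightarrow> real \<Rightarrow> bool" where
  "outward X \<equiv> inward (- X)"

definition external_tangency :: "vfield \<Rightarrow> (real \<Rightarrow> real \<times> real) \<Rightarrow> real \<Rightarrow> bool" where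
  "external_tangency X \<Gamma> s \<longleftrightarrow> tangent_at X \<Gamma> s \<and>
     (\<exists>\<epsilon>>0. \<exists>\<phi>. solves X \<phi> {-\<epsilon>..\<epsilon>} \<and> \<phi> 0 = \<Gamma> s \<and>
        (\<forall>t. 0 < \<bar>t\<bar> \<and> \<bar>t\<bar> \<le> \<epsilon> \<longrightarrow> \<phi> t \<notin> disc \<Gamma>))"

text \<open>A characteristic orbit, followed from the boundary of the disc towards \<open>p\<close>; with respect to
  the time of \<open>X\<close> it tends to \<open>p\<close> forwards or backwards.\<close>

definition characteristic ::
  "vfield \<Rightarrow> real \<times> real \<Rightarrow> (real \<Rightarrow> real \<times> real) \<Rightarrow> (real \<Rightarrow> real \<times> real) \<Rightarrow> bool" where
  "characteristic X p \<Gamma> c \<longleftrightarrow> (solves X c {0..} \<or> solves (- X) c {0..}) \<and>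
     c 0 \<in> range \<Gamma> \<and> (\<forall>t>0. c t \<in> inside (range \<Gamma>)) \<and> (c \<longlongrightarrow> p) at_top"

text \<open>The compact region bounded by \<open>p\<close>, the characteristic orbits \<open>c\<close> and \<open>c'\<close>, and the arc
  \<open>\<Gamma>[s, s']\<close> between their end points.\<close>

definition sector ::
  "real \<times> real \<Rightarrow> (real \<Rightarrow> real \<times> real) \<Rightarrow> real \<Rightarrow> real \<Rightarrow>
   (real \<Rightarrow> real \<times> real) \<Rightarrow> (real \<Rightarrow> real \<times> real) \<Rightarrow> (real \<times> real) set" where
  "sector p \<Gamma> s s' c c' =
     (let B = {p} \<union> c ` {0..} \<union> c' ` {0..} \<union> \<Gamma> ` {s..s'} in B \<union> inside B)"

definition attracting_sector ::
  "vfield \<Rightarrow> real \<times> real \<Rightarrow> (real \<Rightarrow> real \<times> real) \<Rightarrow> real \<Rightarrow> real \<Rightarrow>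
   (real \<Rightarrow> real \<times> real) \<Rightarrow> (real \<Rightarrow> real \<times> real) \<Rightarrow> bool" where
  "attracting_sector X p \<Gamma> s s' c c' \<longleftrightarrow>
     (\<forall>r\<in>{s..s'}. inward X \<Gamma> r) \<and>
     (\<forall>q \<in> sector p \<Gamma> s s' c c' - {p}. tends_to_pt X q p \<and> meets (- X) q (range \<Gamma>))"

definition parabolic_sector ::
  "vfield \<Rightarrow> real \<times> real \<Rightarrow> (real \<Rightarrow> real \<times> real) \<Rightarrow> real \<Rightarrow> real \<Rightarrow>
   (real \<Rightarrow> real \<times> real) \<Rightarrow> (real \<Rightarrow> real \<times> real) \<Rightarrow> bool" where
  "parabolic_sector X p \<Gamma> s s' c c' \<longleftrightarrow>
     attracting_sector X p \<Gamma> s s' c c' \<or> attracting_sector (- X) p \<Gamma> s s' c c'"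

text \<open>In hyperbolic and elliptic sectors the field points inward on one side of a point of tangency
  \<open>\<Gamma> r\<close> and outward on the other; the choice of \<open>Y\<close> covers both orders.\<close>

definition hyperbolic_sector ::
  "vfield \<Rightarrow> real \<times> real \<Rightarrow> (real \<Rightarrow> real \<times> real) \<Rightarrow> real \<Rightarrow> real \<Rightarrow>
   (real \<Rightarrow> real \<times> real) \<Rightarrow> (real \<Rightarrow> real \<times> real) \<Rightarrow> bool" where
  "hyperbolic_sector X p \<Gamma> s s' c c' \<longleftrightarrow>
     (\<exists>Y\<in>{X, - X}. \<exists>r\<in>{s<..<s'}.
        (\<forall>x\<in>{s..<r}. inward Y \<Gamma> x) \<and> (\<forall>x\<in>{r<..s'}. outward Y \<Gamma> x) \<and>
        external_tangency Y \<Gamma> r) \<and>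
     (\<forall>q \<in> sector p \<Gamma> s s' c c' - ({p} \<union> c ` {0..} \<union> c' ` {0..}).
        meets X q (range \<Gamma>) \<and> meets (- X) q (range \<Gamma>))"

text \<open>The orbit \<open>\<phi>\<close> through the (internal) point of tangency is a loop at \<open>p\<close>; the orbits in the
  region it bounds are loops in the disc as well, and all other orbits of the sector tend
  to \<open>p\<close> in one time direction and reach the boundary of the disc in the other.\<close>

definition elliptic_sector ::
  "vfield \<Rightarrow> real \<times> real \<Rightarrow> (real \<Rightarrow> real \<times> real) \<Rightarrow> real \<Rightarrow> real \<Rightarrow>
   (real \<Rightarrow> real \<times> real) \<Rightarrow> (real \<Rightarrow> real \<times> real) \<Rightarrow> bool" where
  "elliptic_sector X p \<Gamma> s s' c c' \<longleftrightarrow>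
     (\<exists>Y\<in>{X, - X}. \<exists>r\<in>{s<..<s'}.
        (\<forall>x\<in>{s..<r}. inward Y \<Gamma> x) \<and> (\<forall>x\<in>{r<..s'}. outward Y \<Gamma> x) \<and>
        tangent_at Y \<Gamma> r \<and>
        (\<exists>\<phi>. homoclinic X p \<phi> \<and> \<phi> 0 = \<Gamma> r \<and>
           (\<forall>t. t \<noteq> 0 \<longrightarrow> \<phi> t \<in> inside (range \<Gamma>)) \<and> range \<phi> \<subseteq> sector p \<Gamma> s s' c c' \<and>
           (\<forall>q \<in> inside (insert p (range \<phi>)).
              \<exists>\<psi>. homoclinic X p \<psi> \<and> \<psi> 0 = q \<and> range \<psi> \<subseteq> disc \<Gamma>) \<and>
           (\<forall>q \<in> sector p \<Gamma> s s' c c' -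
                 (insert p (range \<phi>) \<union> inside (insert p (range \<phi>))).
              tends_to_pt X q p \<and> meets (- X) q (range \<Gamma>) \<or>
              tends_to_pt (- X) q p \<and> meets X q (range \<Gamma>))))"

text \<open>The disc is cut by \<open>n\<close> characteristic orbits \<open>c 0, \<dots>, c (n - 1)\<close> ending at the boundary
  points \<open>\<Gamma> (\<theta> 0), \<dots>, \<Gamma> (\<theta> (n - 1))\<close> in cyclic order; index \<open>n\<close> stands for index \<open>0\<close>, one period
  later. The sectors are Jordan domains since \<open>n \<ge> 2\<close>; this is no loss of generality, as a single
  characteristic orbit can only bound a parabolic sector, which may be subdivided.
  (Centers and foci have no such decomposition.)\<close>

definition sectorial_decomposition ::
  "vfield \<Rightarrow> real \<times> real \<Rightarrow> (real \<Rightarrow> real \<times> real) \<Rightarrow> nat \<Rightarrow> (nat \<Rightarrow> real) \<Rightarrow>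
   (nat \<Rightarrow> real \<Rightarrow> real \<times> real) \<Rightarrow> bool" where
  "sectorial_decomposition X p \<Gamma> n \<theta> c \<longleftrightarrow>
     jordan_C1 \<Gamma> \<and> p \<in> inside (range \<Gamma>) \<and>
     X p = 0 \<and> (\<forall>q \<in> disc \<Gamma> - {p}. X q \<noteq> 0) \<and>
     2 \<le> n \<and> strict_mono_on {..n} \<theta> \<and> \<theta> n = \<theta> 0 + 1 \<and> c n = c 0 \<and>
     (\<forall>i<n. characteristic X p \<Gamma> (c i) \<and> c i 0 = \<Gamma> (\<theta> i)) \<and>
     (\<forall>i<n. parabolic_sector X p \<Gamma> (\<theta> i) (\<theta> (Suc i)) (c i) (c (Suc i)) \<or>
            hyperbolic_sector X p \<Gamma> (\<theta> i) (\<theta> (Suc i)) (c i) (c (Suc i)) \<or>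
            elliptic_sector X p \<Gamma> (\<theta> i) (\<theta> (Suc i)) (c i) (c (Suc i)))"

text \<open>\<open>p\<close> is an isolated critical point of \<open>X\<close> which, in arbitrarily small neighbourhoods, has
  exactly \<open>h\<close> hyperbolic and \<open>e\<close> elliptic sectors.\<close>

definition has_sectors :: "vfield \<Rightarrow> real \<times> real \<Rightarrow> nat \<Rightarrow> nat \<Rightarrow> bool" where
  "has_sectors X p h e \<longleftrightarrow>
     (\<forall>\<epsilon>>0. \<exists>\<Gamma> n \<theta> c. sectorial_decomposition X p \<Gamma> n \<theta> c \<and> disc \<Gamma> \<subseteq> ball p \<epsilon> \<and>
        card {i. i < n \<and> hyperbolic_sector X p \<Gamma> (\<theta> i) (\<theta> (Suc i)) (c i) (c (Suc i))} = h \<and>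
        card {i. i < n \<and> elliptic_sector X p \<Gamma> (\<theta> i) (\<theta> (Suc i)) (c i) (c (Suc i))} = e)"

end

theory Submission
  imports Defs "HOL-Real_Asymp.Real_Asymp"
begin

text \<open>In the coordinates \<open>x = u / v\<close>, \<open>w = 1 / v\<close> the normal form \<open>u' = v - u\<^sup>2\<close>, \<open>v' = - u v\<close> reads
  \<open>x' = 1\<close>, \<open>w' = x\<close>. Hence its flow consists of projective maps, given explicitly by
  \<open>(u + v t, v) / D(t)\<close> with \<open>D(t) = 1 + u t + v t\<^sup>2 / 2\<close>, and each function
  \<open>F\<^sub>c = u\<^sup>2 / 2 - v + c v\<^sup>2\<close> is divided by \<open>D(t)\<^sup>2\<close> along the flow. The circle
  \<open>F\<^bsub>1/2\<^esub> = 3/2\<close> is therefore crossed transversally except at its top and its bottom point, the orbit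
  through the top being the ellipse \<open>F\<^bsub>1/3\<^esub> = 0\<close>. The two halves of the horizontal axis cut the disc into
  an elliptic sector (\<open>v \<ge> 0\<close>) and a hyperbolic one (\<open>v \<le> 0\<close>). Rescaling
  \<open>(u, v, t)\<close> with weights \<open>(1, 2, -1)\<close> makes the disc arbitrarily small, and a further dilation
  produces the parameter \<open>a\<close>.\<close>

section \<open>Linear conjugacies preserve sectors\<close>

lemma inside_injective_linear_image:
  fixes A :: "'a::euclidean_space \<Rightarrow> 'a"
  assumes "linear A" "inj A"
  shows "inside (A ` S) = A ` inside S"
proof -
  have surj: "surj A" using assms by (rule eucl.linear_inj_imp_surj)
  have lin: "linear (inv A)" using assms by (rule eucl.inj_linear_imp_inv_linear)
  have compl: "- A ` S = A ` (- S)"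
    using assms(2) surj by (simp add: bij_def bij_image_Compl_eq)
  have hom: "homeomorphism (- S) (A ` (- S)) A (inv A)"
    using assms lin by (auto simp: homeomorphism_def image_image
        intro: linear_continuous_on linear_linear[THEN iffD2] linear_conv_bounded_linear[THEN iffD1])
  have bdd: "bounded (A ` T) \<longleftrightarrow> bounded T" for T
  proof
    assume "bounded (A ` T)"
    then have "bounded (inv A ` A ` T)"
      using lin linear_conv_bounded_linear bounded_linear_image by blast
    then show "bounded T" using assms(2) by (simp add: image_image)
  next
    assume "bounded T"
    then show "bounded (A ` T)"
      using assms(1) linear_conv_bounded_linear bounded_linear_image by blast
  qed
  have "A x \<in> inside (A ` S) \<longleftrightarrow> x \<in> inside S" for x
  proof (cases "x \<in> S")
    case True then show ?thesis by (simp add: inside_def)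
  next
    case False
    then have "connected_component_set (- A ` S) (A x) = A ` connected_component_set (- S) x"
      using connected_component_set_homeomorphism[OF hom, of x] compl by simp
    then show ?thesis
      using False assms(2) by (simp add: inside_def bdd inj_image_mem_iff)
  qed
  then show ?thesis using surj by (metis assms(2) inj_image_mem_iff set_eqI surjE)
qed

text \<open>\<open>A\<close> maps orbits of \<open>X\<close> to orbits of \<open>Y\<close>, with
  time running \<kappa> times as fast: if \<phi> solves \<open>X\<close>, then
  \<open>\<lambda>t. A (\<phi> (\<kappa> * t))\<close> solves \<open>Y\<close>. Since \<kappa> is
  positive, the direction of time is kept.\<close>

locale linear_conjugacy =
  fixes A :: "real \<times> real \<Rightarrow> real \<times> real" and \<kappa> :: real and X Y :: vfield
  assumes linear: "linear A" and inj: "inj A" and pos: "\<kappa> > 0"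
    and conj: "Y (A z) = \<kappa> *\<^sub>R A (X z)"
begin

lemma surj: "surj A"
  using linear inj by (rule eucl.linear_inj_imp_surj)

lemma bounded_linear: "bounded_linear A"
  using linear linear_conv_bounded_linear by blast

lemma image_inside: "inside (A ` S) = A ` inside S"
  using linear inj by (rule inside_injective_linear_image)

lemma mem_image_iff: "A x \<in> A ` S \<longleftrightarrow> x \<in> S"
  using inj by (rule inj_image_mem_iff)

lemma eq_zero_iff: "A x = 0 \<longleftrightarrow> x = 0"
  using linear_0[OF linear] inj by (metis injD)

lemma uminus: "linear_conjugacy A \<kappa> (- X) (- Y)"
  by (rule linear_conjugacy.intro) (simp_all add: linear inj pos conj linear_neg[OF linear])

text \<open>Turns each of the one-way transfer results below into an equivalence.\<close>

lemma inverse: "linear_conjugacy (inv A) (1 / \<kappa>) Y X"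
proof (rule linear_conjugacy.intro)
  show "linear (inv A)" using linear inj by (rule eucl.inj_linear_imp_inv_linear)
  then interpret B: linear "inv A" .
  show "inj (inv A)" using surj by (rule surj_imp_inj_inv)
  show "1 / \<kappa> > 0" using pos by simp
  fix z
  obtain w where "z = A w" using surjD[OF surj] by blast
  then show "X (inv A z) = (1 / \<kappa>) *\<^sub>R inv A (Y z)"
    using pos inj by (simp add: conj B.scaleR)
qed

section \<open>Transfer of orbits\<close>

text \<open>Chain rule for the time change, then the bounded linear map. The domain is stated as a
  preimage so that half-lines, the whole line and compact intervals are all instances.\<close>

lemma solves:
  assumes "solves X \<phi> I"
  shows "solves Y (\<lambda>t. A (\<phi> (\<kappa> * t))) {t. \<kappa> * t \<in> I}"
  unfolding solves_def
proof
  fix t assume "t \<in> {t. \<kappa> * t \<in> I}"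
  then have "(\<phi> has_vector_derivative X (\<phi> (\<kappa> * t))) (at (\<kappa> * t) within I)"
    using assms by (simp add: solves_def)
  then have "(\<phi> has_vector_derivative X (\<phi> (\<kappa> * t))) (at (\<kappa> * t) within (*) \<kappa> ` {t. \<kappa> * t \<in> I})"
    by (rule has_vector_derivative_within_subset) auto
  moreover have "((*) \<kappa> has_vector_derivative \<kappa>) (at t within {t. \<kappa> * t \<in> I})"
    by (auto intro!: derivative_eq_intros)
  ultimately have "(\<phi> \<circ> (*) \<kappa> has_vector_derivative \<kappa> *\<^sub>R X (\<phi> (\<kappa> * t))) (at t within {t. \<kappa> * t \<in> I})"
    by (intro vector_diff_chain_within)
  then have "((\<lambda>t. A ((\<phi> \<circ> (*) \<kappa>) t)) has_vector_derivative A (\<kappa> *\<^sub>R X (\<phi> (\<kappa> * t))))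
      (at t within {t. \<kappa> * t \<in> I})"
    by (rule bounded_linear.has_vector_derivative[OF bounded_linear])
  then show "((\<lambda>t. A (\<phi> (\<kappa> * t))) has_vector_derivative Y (A (\<phi> (\<kappa> * t))))
      (at t within {t. \<kappa> * t \<in> I})"
    by (simp add: conj linear_scale[OF linear])
qed

lemma solves_atLeast: "solves X \<phi> {0..} \<Longrightarrow> solves Y (\<lambda>t. A (\<phi> (\<kappa> * t))) {0..}"
  using solves[of \<phi> "{0..}"] pos by (simp add: zero_le_mult_iff not_le atLeast_def)

lemma solves_UNIV: "solves X \<phi> UNIV \<Longrightarrow> solves Y (\<lambda>t. A (\<phi> (\<kappa> * t))) UNIV"
  using solves[of \<phi> UNIV] by simp

lemma solves_interval:
  assumes "solves X \<phi> {a..b}"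
  shows "solves Y (\<lambda>t. A (\<phi> (\<kappa> * t))) {a / \<kappa>..b / \<kappa>}"
proof -
  have "{t. \<kappa> * t \<in> {a..b}} = {a / \<kappa>..b / \<kappa>}"
    using pos by (auto simp: field_simps)
  then show ?thesis using solves[OF assms] by simp
qed

lemma tendsto_at_top:
  assumes "(\<phi> \<longlongrightarrow> p) at_top"
  shows "((\<lambda>t. A (\<phi> (\<kappa> * t))) \<longlongrightarrow> A p) at_top"
proof (rule bounded_linear.tendsto[OF bounded_linear])
  have "filterlim (\<lambda>t. \<kappa> * t) at_top at_top"
    using pos by (intro filterlim_tendsto_pos_mult_at_top[OF tendsto_const]) (auto simp: filterlim_ident)
  then show "((\<lambda>t. \<phi> (\<kappa> * t)) \<longlongrightarrow> p) at_top"
    by (rule filterlim_compose[OF assms])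
qed

lemma tendsto_at_bot:
  assumes "(\<phi> \<longlongrightarrow> p) at_bot"
  shows "((\<lambda>t. A (\<phi> (\<kappa> * t))) \<longlongrightarrow> A p) at_bot"
proof (rule bounded_linear.tendsto[OF bounded_linear])
  have "filterlim (\<lambda>t. \<kappa> * t) at_bot at_bot"
    using pos by (intro filterlim_tendsto_pos_mult_at_bot[OF tendsto_const]) (auto simp: filterlim_ident)
  then show "((\<lambda>t. \<phi> (\<kappa> * t)) \<longlongrightarrow> p) at_bot"
    by (rule filterlim_compose[OF assms])
qed

lemma tends_to_pt: "tends_to_pt X q p \<Longrightarrow> tends_to_pt Y (A q) (A p)"
  unfolding tends_to_pt_def
  by (elim exE conjE, rule_tac x="\<lambda>t. A (\<phi> (\<kappa> * t))" in exI)
     (auto intro: solves_atLeast tendsto_at_top)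

lemma meets: "meets X q S \<Longrightarrow> meets Y (A q) (A ` S)"
  unfolding meets_def
proof (elim exE conjE)
  fix \<phi> T assume "0 \<le> T" "solves X \<phi> {0..T}" "\<phi> 0 = q" "\<phi> T \<in> S"
  then show "\<exists>\<phi> T. 0 \<le> T \<and> solves Y \<phi> {0..T} \<and> \<phi> 0 = A q \<and> \<phi> T \<in> A ` S"
    using solves_interval[of \<phi> 0 T] pos
    by (intro exI[of _ "\<lambda>t. A (\<phi> (\<kappa> * t))"] exI[of _ "T / \<kappa>"]) auto
qed

lemma homoclinic: "homoclinic X p \<phi> \<Longrightarrow> homoclinic Y (A p) (\<lambda>t. A (\<phi> (\<kappa> * t)))"
  unfolding homoclinic_def by (auto intro: solves_UNIV tendsto_at_top tendsto_at_bot)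

lemma range_reparam: "range (\<lambda>t. A (\<phi> (\<kappa> * t))) = A ` range \<phi>"
proof -
  have "range (\<lambda>t. \<kappa> * t) = UNIV"
    using pos by (intro surjI[of _ "\<lambda>t. t / \<kappa>"]) auto
  then have "range (\<lambda>t. \<phi> (\<kappa> * t)) = range \<phi>" by (metis image_image)
  then show ?thesis by (metis image_image)
qed

lemma image_atLeast_reparam: "(\<lambda>t. A (c (\<kappa> * t))) ` {0..} = A ` c ` {0..}"
proof -
  have "(\<lambda>t. \<kappa> * t) ` {0..} = {0..}"
  proof (intro equalityI subsetI)
    fix x :: real assume "x \<in> {0..}"
    then show "x \<in> (\<lambda>t. \<kappa> * t) ` {0..}"
      using pos by (intro image_eqI[of _ _ "x / \<kappa>"]) auto
  qed (use pos in auto)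
  then have "(\<lambda>t. c (\<kappa> * t)) ` {0..} = c ` {0..}" by (metis image_image)
  then show ?thesis by (metis image_image)
qed

section \<open>Transfer of the boundary curve and its contact with the field\<close>

lemma range_compose: "range (A \<circ> \<Gamma>) = A ` range \<Gamma>"
  by (simp add: image_comp)

lemma disc: "disc (A \<circ> \<Gamma>) = A ` disc \<Gamma>"
  unfolding disc_def range_compose image_inside by auto

lemma vector_derivative:
  assumes "jordan_C1 \<Gamma>"
  shows "vector_derivative (A \<circ> \<Gamma>) (at s) = A (vector_derivative \<Gamma> (at s))"
proof (rule vector_derivative_at)
  have "(\<Gamma> has_vector_derivative vector_derivative \<Gamma> (at s)) (at s)"
    using assms by (auto simp: jordan_C1_def C1_differentiable_on_eq vector_derivative_works)
  then show "(A \<circ> \<Gamma> has_vector_derivative A (vector_derivative \<Gamma> (at s))) (at s)"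
    unfolding o_def by (rule bounded_linear.has_vector_derivative[OF bounded_linear])
qed

lemma jordan_C1:
  assumes "jordan_C1 \<Gamma>"
  shows "jordan_C1 (A \<circ> \<Gamma>)"
  unfolding jordan_C1_def
proof (intro conjI allI)
  have d: "\<And>s. (\<Gamma> has_vector_derivative vector_derivative \<Gamma> (at s)) (at s)"
    and c: "continuous_on UNIV (\<lambda>s. vector_derivative \<Gamma> (at s))"
    using assms by (auto simp: jordan_C1_def C1_differentiable_on_eq vector_derivative_works)
  show "A \<circ> \<Gamma> C1_differentiable_on UNIV"
    unfolding C1_differentiable_on_def
  proof (intro exI[of _ "\<lambda>s. A (vector_derivative \<Gamma> (at s))"] conjI ballI)
    show "(A \<circ> \<Gamma> has_vector_derivative A (vector_derivative \<Gamma> (at s))) (at s)" for s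
      unfolding o_def using d by (rule bounded_linear.has_vector_derivative[OF bounded_linear])
    show "continuous_on UNIV (\<lambda>s. A (vector_derivative \<Gamma> (at s)))"
      by (rule bounded_linear.continuous_on[OF bounded_linear c])
  qed
  show "vector_derivative (A \<circ> \<Gamma>) (at s) \<noteq> 0" for s
    using assms by (auto simp: vector_derivative eq_zero_iff jordan_C1_def)
  show "(A \<circ> \<Gamma>) (s + 1) = (A \<circ> \<Gamma>) s" for s
    using assms by (simp add: jordan_C1_def)
  show "inj_on (A \<circ> \<Gamma>) {0..<1}"
    using assms inj_on_subset[OF inj] by (intro comp_inj_on) (auto simp: jordan_C1_def)
qed

text \<open>Both vectors are transformed by the injective map \<open>A\<close>, and the additional
  factor \<kappa> on the field is absorbed into the coefficient of collinearity.\<close>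

lemma tangent_at:
  assumes "jordan_C1 \<Gamma>"
  shows "tangent_at Y (A \<circ> \<Gamma>) s \<longleftrightarrow> tangent_at X \<Gamma> s"
proof -
  have "(\<exists>c. A y = c *\<^sub>R \<kappa> *\<^sub>R A x) \<longleftrightarrow> (\<exists>c. y = c *\<^sub>R x)" for x y
  proof
    assume "\<exists>c. A y = c *\<^sub>R \<kappa> *\<^sub>R A x"
    then obtain c where "A y = A ((c * \<kappa>) *\<^sub>R x)"
      by (auto simp: linear_scale[OF linear])
    then show "\<exists>c. y = c *\<^sub>R x" using inj by (auto dest: injD)
  next
    assume "\<exists>c. y = c *\<^sub>R x"
    then obtain c where "y = c *\<^sub>R x" ..
    then show "\<exists>c. A y = c *\<^sub>R \<kappa> *\<^sub>R A x"
      using pos by (intro exI[of _ "c / \<kappa>"]) (simp add: linear_scale[OF linear])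
  qed
  then show ?thesis
    using pos by (simp add: tangent_at_def collinear_lemma vector_derivative[OF assms] conj eq_zero_iff)
qed

text \<open>Inwardness is tested on straight segments along the field. The linear \<open>A\<close>
  maps these to straight segments, and the factor \<kappa> of the field shrinks the admissible range
  to \<open>\<epsilon> / \<kappa>\<close>.\<close>

lemma inward:
  assumes "jordan_C1 \<Gamma>" "inward X \<Gamma> s"
  shows "inward Y (A \<circ> \<Gamma>) s"
proof -
  obtain \<epsilon> where "\<epsilon> > 0"
    and \<epsilon>: "\<And>t. 0 < t \<Longrightarrow> t < \<epsilon> \<Longrightarrow> \<Gamma> s + t *\<^sub>R X (\<Gamma> s) \<in> inside (range \<Gamma>)"
    using assms(2) by (auto simp: inward_def)
  have "(A \<circ> \<Gamma>) s + t *\<^sub>R Y ((A \<circ> \<Gamma>) s) \<in> inside (range (A \<circ> \<Gamma>))" if "0 < t" "t < \<epsilon> / \<kappa>" for t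
  proof -
    have "(A \<circ> \<Gamma>) s + t *\<^sub>R Y ((A \<circ> \<Gamma>) s) = A (\<Gamma> s + (t * \<kappa>) *\<^sub>R X (\<Gamma> s))"
      by (simp add: conj linear_add[OF linear] linear_scale[OF linear])
    moreover have "0 < t * \<kappa>" "t * \<kappa> < \<epsilon>"
      using that pos by (auto simp: field_simps)
    ultimately show ?thesis
      using \<epsilon> unfolding range_compose image_inside by simp
  qed
  moreover have "\<epsilon> / \<kappa> > 0" using \<open>\<epsilon> > 0\<close> pos by simp
  ultimately show ?thesis
    using assms tangent_at unfolding inward_def by blast
qed

lemma external_tangency:
  assumes "jordan_C1 \<Gamma>" "external_tangency X \<Gamma> s"
  shows "external_tangency Y (A \<circ> \<Gamma>) s"
proof -
  obtain \<epsilon> \<phi> where "\<epsilon> > 0" and \<phi>: "solves X \<phi> {-\<epsilon>..\<epsilon>}" "\<phi> 0 = \<Gamma> s"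
    and out: "\<And>t. 0 < \<bar>t\<bar> \<Longrightarrow> \<bar>t\<bar> \<le> \<epsilon> \<Longrightarrow> \<phi> t \<notin> disc \<Gamma>"
    using assms(2) by (auto simp: external_tangency_def)
  have "\<epsilon> / \<kappa> > 0" using \<open>\<epsilon> > 0\<close> pos by simp
  moreover have "solves Y (\<lambda>t. A (\<phi> (\<kappa> * t))) {-(\<epsilon> / \<kappa>)..\<epsilon> / \<kappa>}"
    using solves_interval[OF \<phi>(1)] by simp
  moreover have "A (\<phi> (\<kappa> * t)) \<notin> disc (A \<circ> \<Gamma>)" if "0 < \<bar>t\<bar>" "\<bar>t\<bar> \<le> \<epsilon> / \<kappa>" for t
    using that pos out[of "\<kappa> * t"] by (simp add: disc mem_image_iff abs_mult field_simps)
  ultimately show ?thesis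
    using assms tangent_at \<phi>(2) unfolding external_tangency_def
    by (intro conjI exI[of _ "\<epsilon> / \<kappa>"] exI[of _ "\<lambda>t. A (\<phi> (\<kappa> * t))"]) auto
qed

lemma characteristic:
  assumes "characteristic X p \<Gamma> c"
  shows "characteristic Y (A p) (A \<circ> \<Gamma>) (\<lambda>t. A (c (\<kappa> * t)))"
proof -
  interpret neg: linear_conjugacy A \<kappa> "- X" "- Y" by (rule uminus)
  show ?thesis
    using assms pos unfolding characteristic_def range_compose image_inside
    by (auto intro: solves_atLeast neg.solves_atLeast tendsto_at_top)
qed

section \<open>Transfer of sectors and decompositions\<close>

text \<open>The change of time leaves the traces of the bounding orbits unchanged, and
  \<open>inside\<close> commutes with \<open>A\<close>.\<close>

lemma sector:
  "sector (A p) (A \<circ> \<Gamma>) s s' (\<lambda>t. A (c (\<kappa> * t))) (\<lambda>t. A (c' (\<kappa> * t))) = A ` sector p \<Gamma> s s' c c'"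
proof -
  have "{A p} \<union> A ` c ` {0..} \<union> A ` c' ` {0..} \<union> A ` \<Gamma> ` {s..s'}
      = A ` ({p} \<union> c ` {0..} \<union> c' ` {0..} \<union> \<Gamma> ` {s..s'})" (is "?B' = A ` ?B") by auto
  moreover have "A ` ?B \<union> inside (A ` ?B) = A ` (?B \<union> inside ?B)"
    by (subst image_inside) (rule image_Un[symmetric])
  ultimately show ?thesis
    unfolding sector_def image_atLeast_reparam Let_def image_comp[symmetric] by (simp only:)
qed

lemma attracting_sector:
  assumes "jordan_C1 \<Gamma>" "attracting_sector X p \<Gamma> s s' c c'"
  shows "attracting_sector Y (A p) (A \<circ> \<Gamma>) s s' (\<lambda>t. A (c (\<kappa> * t))) (\<lambda>t. A (c' (\<kappa> * t)))"
proof -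
  interpret neg: linear_conjugacy A \<kappa> "- X" "- Y" by (rule uminus)
  have "tends_to_pt Y q (A p) \<and> meets (- Y) q (A ` range \<Gamma>)"
    if "q \<in> A ` sector p \<Gamma> s s' c c' - {A p}" for q
  proof -
    obtain q' where "q = A q'" "q' \<in> sector p \<Gamma> s s' c c' - {p}" using \<open>q \<in> _\<close> by blast
    then show ?thesis
      using assms(2) tends_to_pt neg.meets unfolding attracting_sector_def by blast
  qed
  then show ?thesis
    using assms unfolding attracting_sector_def sector range_compose by (blast intro: inward)
qed

lemma parabolic_sector:
  assumes "jordan_C1 \<Gamma>" "parabolic_sector X p \<Gamma> s s' c c'"
  shows "parabolic_sector Y (A p) (A \<circ> \<Gamma>) s s' (\<lambda>t. A (c (\<kappa> * t))) (\<lambda>t. A (c' (\<kappa> * t)))"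
proof -
  interpret neg: linear_conjugacy A \<kappa> "- X" "- Y" by (rule uminus)
  show ?thesis
    using assms attracting_sector neg.attracting_sector unfolding parabolic_sector_def by blast
qed

lemma hyperbolic_sector:
  assumes "jordan_C1 \<Gamma>" "hyperbolic_sector X p \<Gamma> s s' c c'"
  shows "hyperbolic_sector Y (A p) (A \<circ> \<Gamma>) s s' (\<lambda>t. A (c (\<kappa> * t))) (\<lambda>t. A (c' (\<kappa> * t)))"
proof -
  interpret neg: linear_conjugacy A \<kappa> "- X" "- Y" by (rule uminus)
  obtain Z r where Z: "Z \<in> {X, - X}" and r: "r \<in> {s<..<s'}"
    and tang: "\<forall>x\<in>{s..<r}. inward Z \<Gamma> x" "\<forall>x\<in>{r<..s'}. outward Z \<Gamma> x" "external_tangency Z \<Gamma> r"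
    using assms(2) unfolding hyperbolic_sector_def by blast
  \<comment> \<open>\<open>W\<close> is the image of the chosen orientation \<open>Z\<close>: it is
    \<open>Y\<close> for \<open>X\<close> and \<open>- Y\<close> for \<open>- X\<close>, so the
    order of the inward and the outward arc is kept.\<close>
  obtain W where W: "W \<in> {Y, - Y}" "linear_conjugacy A \<kappa> Z W"
    using Z uminus linear_conjugacy_axioms by blast
  interpret Z: linear_conjugacy A \<kappa> Z W by (rule W(2))
  interpret Zneg: linear_conjugacy A \<kappa> "- Z" "- W" by (rule Z.uminus)
  have orbits: "\<forall>q \<in> sector p \<Gamma> s s' c c' - ({p} \<union> c ` {0..} \<union> c' ` {0..}).
        meets X q (range \<Gamma>) \<and> meets (- X) q (range \<Gamma>)"
    using assms(2) unfolding hyperbolic_sector_def by blast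
  show ?thesis
    unfolding hyperbolic_sector_def sector range_compose image_atLeast_reparam
  proof (intro conjI bexI[of _ W] bexI[of _ r] ballI W r)
    show "inward W (A \<circ> \<Gamma>) x" if "x \<in> {s..<r}" for x
      using that tang assms(1) Z.inward by blast
    show "outward W (A \<circ> \<Gamma>) x" if "x \<in> {r<..s'}" for x
      using that tang assms(1) Zneg.inward by blast
    show "external_tangency W (A \<circ> \<Gamma>) r"
      using tang assms(1) Z.external_tangency by blast
    fix q assume q: "q \<in> A ` sector p \<Gamma> s s' c c' - ({A p} \<union> A ` c ` {0..} \<union> A ` c' ` {0..})"
    then obtain q' where q': "q = A q'" "q' \<in> sector p \<Gamma> s s' c c'" by auto
    with q have "q' \<notin> {p} \<union> c ` {0..} \<union> c' ` {0..}" by auto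
    with q' orbits have "meets X q' (range \<Gamma>)" "meets (- X) q' (range \<Gamma>)" by blast+
    then show "meets Y q (A ` range \<Gamma>)" "meets (- Y) q (A ` range \<Gamma>)"
      using meets neg.meets q' by auto
  qed
qed

lemma elliptic_sector:
  assumes "jordan_C1 \<Gamma>" "elliptic_sector X p \<Gamma> s s' c c'"
  shows "elliptic_sector Y (A p) (A \<circ> \<Gamma>) s s' (\<lambda>t. A (c (\<kappa> * t))) (\<lambda>t. A (c' (\<kappa> * t)))"
proof -
  interpret neg: linear_conjugacy A \<kappa> "- X" "- Y" by (rule uminus)
  obtain Z r \<phi> where Z: "Z \<in> {X, - X}" and r: "r \<in> {s<..<s'}"
    and tang: "\<forall>x\<in>{s..<r}. inward Z \<Gamma> x" "\<forall>x\<in>{r<..s'}. outward Z \<Gamma> x" "tangent_at Z \<Gamma> r"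
    and \<phi>: "homoclinic X p \<phi>" "\<phi> 0 = \<Gamma> r" "\<forall>t. t \<noteq> 0 \<longrightarrow> \<phi> t \<in> inside (range \<Gamma>)"
      "range \<phi> \<subseteq> sector p \<Gamma> s s' c c'"
    and loops: "\<forall>q \<in> inside (insert p (range \<phi>)).
              \<exists>\<psi>. homoclinic X p \<psi> \<and> \<psi> 0 = q \<and> range \<psi> \<subseteq> disc \<Gamma>"
    and rest: "\<forall>q \<in> sector p \<Gamma> s s' c c' -
                 (insert p (range \<phi>) \<union> inside (insert p (range \<phi>))).
              tends_to_pt X q p \<and> meets (- X) q (range \<Gamma>) \<or>
              tends_to_pt (- X) q p \<and> meets X q (range \<Gamma>)"
    using assms(2) unfolding elliptic_sector_def by blast
  obtain W where W: "W \<in> {Y, - Y}" "linear_conjugacy A \<kappa> Z W"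
    using Z uminus linear_conjugacy_axioms by blast
  interpret Z: linear_conjugacy A \<kappa> Z W by (rule W(2))
  interpret Zneg: linear_conjugacy A \<kappa> "- Z" "- W" by (rule Z.uminus)
  define \<phi>' where "\<phi>' = (\<lambda>t. A (\<phi> (\<kappa> * t)))"
  have ins: "insert (A p) (range \<phi>') = A ` insert p (range \<phi>)"
    by (simp add: \<phi>'_def range_reparam)
  show ?thesis
    unfolding elliptic_sector_def sector range_compose
  proof (intro conjI bexI[of _ W] bexI[of _ r] W r; (rule exI[of _ \<phi>'], intro conjI)?)
    show "\<forall>x\<in>{s..<r}. inward W (A \<circ> \<Gamma>) x"
      using tang assms(1) Z.inward by blast
    show "\<forall>x\<in>{r<..s'}. outward W (A \<circ> \<Gamma>) x"
      using tang assms(1) Zneg.inward by blast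
    show "tangent_at W (A \<circ> \<Gamma>) r"
      using tang assms(1) Z.tangent_at by blast
    show "homoclinic Y (A p) \<phi>'" unfolding \<phi>'_def using \<phi>(1) by (rule homoclinic)
    show "\<phi>' 0 = (A \<circ> \<Gamma>) r" by (simp add: \<phi>'_def \<phi>(2))
    show "\<forall>t. t \<noteq> 0 \<longrightarrow> \<phi>' t \<in> inside (A ` range \<Gamma>)"
      using pos \<phi>(3) by (simp add: \<phi>'_def image_inside mem_image_iff)
    show "range \<phi>' \<subseteq> A ` sector p \<Gamma> s s' c c'"
      using \<phi>(4) by (auto simp: \<phi>'_def)
    show "\<forall>q \<in> inside (insert (A p) (range \<phi>')).
        \<exists>\<psi>. homoclinic Y (A p) \<psi> \<and> \<psi> 0 = q \<and> range \<psi> \<subseteq> disc (A \<circ> \<Gamma>)"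
    proof
      fix q assume "q \<in> inside (insert (A p) (range \<phi>'))"
      then obtain q' where q': "q = A q'" "q' \<in> inside (insert p (range \<phi>))"
        unfolding ins image_inside by blast
      then obtain \<psi> where "homoclinic X p \<psi>" "\<psi> 0 = q'" "range \<psi> \<subseteq> disc \<Gamma>" using loops by blast
      then show "\<exists>\<psi>. homoclinic Y (A p) \<psi> \<and> \<psi> 0 = q \<and> range \<psi> \<subseteq> disc (A \<circ> \<Gamma>)"
        by (intro exI[of _ "\<lambda>t. A (\<psi> (\<kappa> * t))"]) (auto simp: q' disc intro: homoclinic)
    qed
    show "\<forall>q \<in> A ` sector p \<Gamma> s s' c c' -
        (insert (A p) (range \<phi>') \<union> inside (insert (A p) (range \<phi>'))).
        tends_to_pt Y q (A p) \<and> meets (- Y) q (A ` range \<Gamma>) \<or>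
        tends_to_pt (- Y) q (A p) \<and> meets Y q (A ` range \<Gamma>)"
    proof
      fix q assume q: "q \<in> A ` sector p \<Gamma> s s' c c' -
          (insert (A p) (range \<phi>') \<union> inside (insert (A p) (range \<phi>')))"
      then obtain q' where q': "q = A q'" "q' \<in> sector p \<Gamma> s s' c c'" by auto
      then have "q' \<notin> insert p (range \<phi>) \<union> inside (insert p (range \<phi>))"
        using q unfolding ins image_inside by blast
      then have "tends_to_pt X q' p \<and> meets (- X) q' (range \<Gamma>) \<or>
                tends_to_pt (- X) q' p \<and> meets X q' (range \<Gamma>)"
        using q'(2) rest by blast
      then show "tends_to_pt Y q (A p) \<and> meets (- Y) q (A ` range \<Gamma>) \<or>
                tends_to_pt (- Y) q (A p) \<and> meets Y q (A ` range \<Gamma>)"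
        using q'(1) tends_to_pt meets neg.tends_to_pt neg.meets by blast
    qed
  qed
qed

text \<open>Needed as an equivalence because \<open>has_sectors\<close> asks for exact numbers: a
  sector that fails to be hyperbolic must still fail after the transfer.\<close>

lemma hyperbolic_sector_iff:
  assumes "jordan_C1 \<Gamma>"
  shows "hyperbolic_sector Y (A p) (A \<circ> \<Gamma>) s s' (\<lambda>t. A (c (\<kappa> * t))) (\<lambda>t. A (c' (\<kappa> * t)))
    \<longleftrightarrow> hyperbolic_sector X p \<Gamma> s s' c c'"
proof
  interpret B: linear_conjugacy "inv A" "1 / \<kappa>" Y X by (rule inverse)
  assume "hyperbolic_sector Y (A p) (A \<circ> \<Gamma>) s s' (\<lambda>t. A (c (\<kappa> * t))) (\<lambda>t. A (c' (\<kappa> * t)))"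
  from B.hyperbolic_sector[OF jordan_C1[OF assms] this] show "hyperbolic_sector X p \<Gamma> s s' c c'"
    using inj pos by (simp add: o_def)
qed (rule hyperbolic_sector[OF assms])

lemma elliptic_sector_iff:
  assumes "jordan_C1 \<Gamma>"
  shows "elliptic_sector Y (A p) (A \<circ> \<Gamma>) s s' (\<lambda>t. A (c (\<kappa> * t))) (\<lambda>t. A (c' (\<kappa> * t)))
    \<longleftrightarrow> elliptic_sector X p \<Gamma> s s' c c'"
proof
  interpret B: linear_conjugacy "inv A" "1 / \<kappa>" Y X by (rule inverse)
  assume "elliptic_sector Y (A p) (A \<circ> \<Gamma>) s s' (\<lambda>t. A (c (\<kappa> * t))) (\<lambda>t. A (c' (\<kappa> * t)))"
  from B.elliptic_sector[OF jordan_C1[OF assms] this] show "elliptic_sector X p \<Gamma> s s' c c'"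
    using inj pos by (simp add: o_def)
qed (rule elliptic_sector[OF assms])

lemma sectorial_decomposition:
  assumes dec: "sectorial_decomposition X p \<Gamma> n \<theta> c"
  shows "sectorial_decomposition Y (A p) (A \<circ> \<Gamma>) n \<theta> (\<lambda>i t. A (c i (\<kappa> * t)))"
proof -
  have J: "jordan_C1 \<Gamma>" using dec by (simp add: sectorial_decomposition_def)
  have "\<forall>q \<in> disc (A \<circ> \<Gamma>) - {A p}. Y q \<noteq> 0"
    using dec pos by (auto simp: disc conj eq_zero_iff sectorial_decomposition_def)
  moreover have "A p \<in> inside (range (A \<circ> \<Gamma>))"
    unfolding range_compose image_inside using dec by (simp add: sectorial_decomposition_def)
  moreover have "Y (A p) = 0"
    using dec by (simp add: conj eq_zero_iff sectorial_decomposition_def)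
  moreover have "\<forall>i<n. characteristic Y (A p) (A \<circ> \<Gamma>) (\<lambda>t. A (c i (\<kappa> * t))) \<and>
      A (c i (\<kappa> * 0)) = (A \<circ> \<Gamma>) (\<theta> i)"
    using dec characteristic unfolding sectorial_decomposition_def by simp
  moreover have "\<forall>i<n.
      parabolic_sector Y (A p) (A \<circ> \<Gamma>) (\<theta> i) (\<theta> (Suc i)) (\<lambda>t. A (c i (\<kappa> * t))) (\<lambda>t. A (c (Suc i) (\<kappa> * t))) \<or>
      hyperbolic_sector Y (A p) (A \<circ> \<Gamma>) (\<theta> i) (\<theta> (Suc i)) (\<lambda>t. A (c i (\<kappa> * t))) (\<lambda>t. A (c (Suc i) (\<kappa> * t))) \<or>
      elliptic_sector Y (A p) (A \<circ> \<Gamma>) (\<theta> i) (\<theta> (Suc i)) (\<lambda>t. A (c i (\<kappa> * t))) (\<lambda>t. A (c (Suc i) (\<kappa> * t)))"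
    using dec parabolic_sector[OF J] hyperbolic_sector[OF J] elliptic_sector[OF J]
    unfolding sectorial_decomposition_def by blast
  ultimately show ?thesis
    using dec jordan_C1[OF J] unfolding sectorial_decomposition_def by simp
qed

end


section \<open>The normal form and its flow\<close>

definition nf :: vfield where
  "nf = (\<lambda>(u, v). (v - u\<^sup>2, - u * v))"

text \<open>In the overview's coordinates this is the ratio \<open>w(t) / w(0)\<close>. Written as a
  polynomial in \<open>z\<close> and \<open>t\<close>, it also makes sense on the line at infinity
  \<open>snd z = 0\<close>.\<close>

definition den :: "real \<times> real \<Rightarrow> real \<Rightarrow> real" where
  "den z t = 1 + fst z * t + snd z * t\<^sup>2 / 2"

definition flow :: "real \<times> real \<Rightarrow> real \<Rightarrow> real \<times> real" where
  "flow z t = ((fst z + snd z * t) / den z t, snd z / den z t)"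

text \<open>Divided by the square of \<open>snd z\<close>, this is the first integral
  \<open>x^2 / 2 - w\<close> plus the constant \<open>c\<close>. The zero sets are invariant conics,
  all tangent to the horizontal axis at the origin.\<close>

definition pencil :: "real \<Rightarrow> real \<times> real \<Rightarrow> real" where
  "pencil c z = (fst z)\<^sup>2 / 2 - snd z + c * (snd z)\<^sup>2"

lemma flow_0 [simp]: "flow z 0 = z"
  by (simp add: flow_def den_def)

lemma flow_has_vector_derivative:
  assumes "den z t \<noteq> 0"
  shows "(flow z has_vector_derivative nf (flow z t)) (at t within S)"
proof -
  have den': "(den z has_real_derivative fst z + snd z * t) (at t within S)"
    unfolding den_def by (auto intro!: derivative_eq_intros simp: power2_eq_square)
  have "((\<lambda>t. (fst z + snd z * t) / den z t) has_vector_derivative fst (nf (flow z t))) (at t within S)"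
    unfolding has_real_derivative_iff_has_vector_derivative[symmetric] using assms
    by (auto intro!: derivative_eq_intros den' simp: nf_def flow_def field_simps power2_eq_square)
  moreover have "((\<lambda>t. snd z / den z t) has_vector_derivative snd (nf (flow z t))) (at t within S)"
    unfolding has_real_derivative_iff_has_vector_derivative[symmetric] using assms
    by (auto intro!: derivative_eq_intros den' simp: nf_def flow_def field_simps power2_eq_square)
  ultimately show ?thesis
    unfolding flow_def using has_vector_derivative_Pair by fastforce
qed

lemma solves_flow: "(\<And>t. t \<in> I \<Longrightarrow> den z t \<noteq> 0) \<Longrightarrow> solves nf (flow z) I"
  by (simp add: solves_def flow_has_vector_derivative)

lemma pencil_flow:
  assumes "den z t \<noteq> 0"
  shows "pencil c (flow z t) = pencil c z / (den z t)\<^sup>2"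
proof -
  have "pencil c (flow z t) * (den z t)\<^sup>2
      = (fst z + snd z * t)\<^sup>2 / 2 - snd z * den z t + c * (snd z)\<^sup>2"
    using assms by (simp add: pencil_def flow_def field_simps power2_eq_square)
  \<comment> \<open>The terms in \<open>t\<close> from the square and from
    \<open>snd z * den z t\<close> cancel.\<close>
  also have "\<dots> = pencil c z"
    by (simp add: pencil_def den_def field_simps power2_eq_square)
  finally show ?thesis using assms by (simp add: field_simps)
qed

text \<open>The reflection in the vertical axis reverses time, so each statement about backward
  orbits follows from one about forward orbits of the mirrored point.\<close>

interpretation reflection: linear_conjugacy "\<lambda>z. (- fst z, snd z)" 1 nf "- nf"
proof (rule linear_conjugacy.intro)
  show "linear (\<lambda>z :: real \<times> real. (- fst z, snd z))"
    by (rule linearI) auto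
qed (auto simp: inj_def nf_def)

text \<open>For \<open>snd z > 0\<close> the denominator grows quadratically in both time
  directions, while the numerators are at most linear.\<close>

lemma flow_tendsto_0:
  assumes "snd z > 0"
  shows "(flow z \<longlongrightarrow> (0, 0)) at_top" "(flow z \<longlongrightarrow> (0, 0)) at_bot"
proof -
  obtain u v where z: "z = (u, v)" by force
  have v: "v > 0" using assms z by simp
  show "(flow z \<longlongrightarrow> (0, 0)) at_top" "(flow z \<longlongrightarrow> (0, 0)) at_bot"
    unfolding flow_def den_def z fst_conv snd_conv
    by (rule tendsto_Pair; use v in real_asymp)+
qed

section \<open>Reaching a level curve\<close>

text \<open>\<open>T\<close> is the least element of the compact level set; a smaller value before
  \<open>T\<close> would force an earlier hit by the intermediate value theorem. Applied to
  \<open>den\<close>, the lower bound keeps \<open>flow\<close> free of poles up to the time of the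
  hit.\<close>

lemma first_hit:
  fixes g :: "real \<Rightarrow> real"
  assumes "continuous_on {0..b} g" "0 \<le> b" "d \<le> g 0" "g b \<le> d"
  obtains T where "0 \<le> T" "T \<le> b" "g T = d" "\<And>t. 0 \<le> t \<Longrightarrow> t \<le> T \<Longrightarrow> d \<le> g t"
proof -
  define S where "S = {t \<in> {0..b}. g t = d}"
  have "closed S"
    unfolding S_def using assms(1) by (intro continuous_closed_preimage_constant) auto
  moreover have "bounded S"
    by (rule bounded_subset[OF bounded_closed_interval[of 0 b]]) (auto simp: S_def)
  ultimately have "compact S" by (simp add: compact_eq_bounded_closed)
  moreover have hit: "\<exists>x\<in>S. x \<le> t" if "0 \<le> t" "t \<le> b" "g t \<le> d" for t
  proof -
    have "continuous_on {0..t} g" using assms(1) that by (auto intro: continuous_on_subset)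
    then have "\<exists>x\<ge>0. x \<le> t \<and> g x = d" using that assms(3) by (intro IVT2') auto
    then obtain x where "0 \<le> x" "x \<le> t" "g x = d" by blast
    then show ?thesis using that by (auto simp: S_def)
  qed
  ultimately obtain T where T: "T \<in> S" "\<And>t. t \<in> S \<Longrightarrow> T \<le> t"
    using compact_attains_inf[of S] hit[of b] assms(2,4) by blast
  have "d \<le> g t" if "0 \<le> t" "t \<le> T" for t
  proof (rule ccontr)
    assume "\<not> d \<le> g t"
    then have "\<exists>x\<in>S. x \<le> t" using hit[of t] that T(1) by (simp add: S_def)
    then have "t = T" using T(2) that by force
    then show False using T(1) \<open>\<not> d \<le> g t\<close> by (simp add: S_def)
  qed
  then show ?thesis using T(1) that by (auto simp: S_def)
qed

text \<open>Along the flow the value is \<open>pencil c z / (den z t)^2\<close>, which equals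
  \<open>e\<close> when \<open>den z t\<close> is the square root in the last assumption. It remains
  to find a time \<open>b\<close> by which \<open>den\<close> has fallen that far from its initial
  value 1.\<close>

lemma meets_pencil:
  assumes "0 < pencil c z" "pencil c z \<le> e" "0 \<le> b" "den z b \<le> sqrt (pencil c z / e)"
  shows "meets nf z {z. pencil c z = e}"
proof -
  let ?d = "sqrt (pencil c z / e)"
  have e: "e > 0" using assms by linarith
  then have d: "?d > 0" "?d \<le> 1" using assms by auto
  have cont: "continuous_on {0..b} (den z)" unfolding den_def by (auto intro!: continuous_intros)
  have "?d \<le> den z 0" using d(2) by (simp add: den_def)
  from first_hit[OF cont assms(3) this assms(4)]
  obtain T where T: "0 \<le> T" "den z T = ?d" "\<And>t. 0 \<le> t \<Longrightarrow> t \<le> T \<Longrightarrow> ?d \<le> den z t"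
    by metis
  have "solves nf (flow z) {0..T}"
    using T(3) d(1) by (intro solves_flow) force
  moreover have "pencil c (flow z T) = e"
    using T(2) d e assms(1) by (subst pencil_flow) auto
  ultimately show ?thesis
    unfolding meets_def using T(1) by (intro exI[of _ "flow z"] exI[of _ T]) auto
qed

lemma meets_pencil_below:
  assumes "snd z < 0" "c \<ge> 0" "pencil c z \<le> e"
  shows "meets nf z {z. pencil c z = e}"
proof -
  \<comment> \<open>Below the axis \<open>den\<close> is a parabola that opens downwards. This
    \<open>b\<close> makes \<open>fst z + snd z * b / 2\<close> at most -1, hence
    \<open>den z b\<close> at most \<open>1 - b\<close>, which is not positive.\<close>
  define b where "b = 2 * (\<bar>fst z\<bar> + 1) / (- snd z) + 1"
  have b: "b \<ge> 1" using assms(1) unfolding b_def by (simp add: divide_nonneg_neg)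
  have "snd z * b / 2 = - (\<bar>fst z\<bar> + 1) + snd z / 2"
    using assms(1) by (simp add: b_def field_simps)
  then have "fst z + snd z * b / 2 \<le> - 1" using assms(1) by linarith
  then have "b * (fst z + snd z * b / 2) \<le> b * - 1" using b by (intro mult_left_mono) auto
  then have "den z b \<le> 0" using b by (simp add: den_def algebra_simps power2_eq_square)
  moreover have pos: "0 < pencil c z" using assms(1,2) unfolding pencil_def
    by (smt (verit) divide_nonneg_pos mult_nonneg_nonneg zero_le_power2)
  then have "0 \<le> sqrt (pencil c z / e)" using assms(3) by simp
  ultimately have "den z b \<le> sqrt (pencil c z / e)" by (rule order_trans)
  then show ?thesis using pos assms(3) b by (intro meets_pencil[where b = b]) auto
qed

lemma meets_circle_left:
  assumes "fst z \<le> 0" "snd z \<ge> 0" "0 < pencil (1/3) z" "pencil (1/2) z \<le> 3/2"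
  shows "meets nf z {z. pencil (1/2) z = 3/2}"
proof -
  obtain u v where z: "z = (u, v)" by force
  have F: "pencil (1/2) z = pencil (1/3) z + v\<^sup>2 / 6"
    by (simp add: pencil_def z field_simps)
  then have pos: "pencil (1/2) z > 0" using assms(3) by (simp add: add_pos_nonneg)
  show ?thesis
  proof (cases "v = 0")
    case True
    then have "u < 0" using assms(1,3) z by (auto simp: pencil_def less_le)
    \<comment> \<open>On the axis \<open>den\<close> is affine in time and reaches zero.\<close>
    then have "den z (- 1 / u) = 0" using True z by (simp add: den_def)
    then show ?thesis
      using \<open>u < 0\<close> pos assms(4) by (intro meets_pencil[where b = "- 1 / u"]) (auto simp: divide_nonpos_neg)
  next
    case False
    then have v: "v > 0" using assms(2) z by simp
    \<comment> \<open>\<open>- u / v\<close> is the vertex of the parabola \<open>den\<close>. The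
      minimum is at most \<open>v / 3\<close> because \<open>z\<close> lies outside the ellipse, and
      the square of \<open>v / 3\<close> is the part \<open>v^2 / 6\<close> of \<open>F\<close>
      divided by \<open>3/2\<close>.\<close>
    have "den z (- u / v) = 1 - u\<^sup>2 / (2 * v)"
      using v by (simp add: den_def z field_simps power2_eq_square)
    also have "\<dots> \<le> v / 3"
      using assms(3) v by (simp add: pencil_def z field_simps power2_eq_square)
    also have "\<dots> \<le> sqrt (pencil (1/2) z / (3/2))"
      using assms(3) F by (intro real_le_rsqrt) (simp add: field_simps)
    finally show ?thesis
      using v assms(1,4) pos z by (intro meets_pencil[where b = "- u / v"]) (auto simp: divide_nonpos_pos)
  qed
qed

text \<open>In this quadrant \<open>den\<close> has no negative term at nonnegative times, so the
  explicit orbit exists for all of them. On the axis the decay is only like \<open>1 / t\<close> and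
  is treated separately.\<close>

lemma tends_to_origin_right:
  assumes "fst z \<ge> 0" "snd z \<ge> 0" "z \<noteq> (0, 0)"
  shows "tends_to_pt nf z (0, 0)"
  unfolding tends_to_pt_def
proof (intro exI[of _ "flow z"] conjI)
  have "den z t > 0" if "t \<ge> 0" for t
    using assms that unfolding den_def by (intro add_pos_nonneg) auto
  then show "solves nf (flow z) {0..}" by (intro solves_flow) force
  show "(flow z \<longlongrightarrow> (0, 0)) at_top"
  proof (cases "snd z = 0")
    case True
    then have u: "fst z > 0" using assms by (cases z) auto
    have "((\<lambda>t. fst z / (1 + fst z * t)) \<longlongrightarrow> 0) at_top"
      using u by real_asymp
    then show ?thesis using True unfolding flow_def den_def by (intro tendsto_Pair) auto
  next
    case False
    then show ?thesis using assms by (intro flow_tendsto_0) auto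
  qed
qed simp

text \<open>A negative value forces \<open>u^2 < 2 * v\<close>, so the quadratic \<open>den\<close>
  has negative discriminant and never vanishes; the limits in both directions are those of
  \<open>flow_tendsto_0\<close>.\<close>

lemma homoclinic_flow:
  assumes "pencil c z < 0" "c \<ge> 0"
  shows "homoclinic nf (0, 0) (flow z)" and "den z t > 0"
proof -
  obtain u v where z: "z = (u, v)" by force
  have uv: "u\<^sup>2 / 2 < v" using assms unfolding pencil_def z
    by (smt (verit) fst_conv mult_nonneg_nonneg snd_conv zero_le_power2)
  then have v: "v > 0" by (smt (verit) divide_nonneg_pos zero_le_power2)
  show pos: "den z t > 0" for t
  proof -
    have "2 * v * den z t = (v * t + u)\<^sup>2 + (2 * v - u\<^sup>2)"
      by (simp add: den_def z field_simps power2_eq_square)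
    also have "\<dots> > 0" using uv by (simp add: add_nonneg_pos)
    finally show ?thesis using v by (simp add: zero_less_mult_iff)
  qed
  show "homoclinic nf (0, 0) (flow z)"
    unfolding homoclinic_def using flow_tendsto_0[of z] v z pos
    by (auto intro!: solves_flow simp: less_imp_neq[symmetric])
qed

section \<open>Obstructions for arbitrary solutions\<close>

text \<open>Integrating factor \<open>exp (- K)\<close>. It shows that solutions of such an equation
  keep their sign, which is used for arbitrary orbits and not only for the explicit
  \<open>flow\<close>.\<close>

lemma linear_ode:
  fixes h k :: "real \<Rightarrow> real"
  assumes "0 \<le> T" "\<And>t. t \<in> {0..T} \<Longrightarrow> (h has_vector_derivative k t * h t) (at t within {0..T})"
    and "continuous_on {0..T} k"
  shows "h T = h 0 * exp (integral {0..T} k)"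
proof -
  define K where "K t = integral {0..t} k" for t
  have K: "(K has_real_derivative k t) (at t within {0..T})" if "t \<in> {0..T}" for t
    unfolding K_def has_real_derivative_iff_has_vector_derivative
    using assms(3) that by (rule integral_has_vector_derivative)
  have "((\<lambda>t. h t * exp (- K t)) has_vector_derivative 0) (at t within {0..T})" if "t \<in> {0..T}" for t
    unfolding has_real_derivative_iff_has_vector_derivative[symmetric]
    using K[OF that] assms(2)[OF that, folded has_real_derivative_iff_has_vector_derivative]
    by (auto intro!: derivative_eq_intros simp: algebra_simps)
  then obtain C where C: "\<And>t. t \<in> {0..T} \<Longrightarrow> h t * exp (- K t) = C"
    using has_vector_derivative_zero_constant[of "{0..T}" "\<lambda>t. h t * exp (- K t)"] by auto
  have "h T * exp (- K T) = h 0" using C[of T] C[of 0] assms(1) by (simp add: K_def)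
  then show ?thesis by (simp add: K_def exp_minus field_simps)
qed

lemma solves_nf_derivatives:
  assumes "solves nf \<phi> I" "t \<in> I"
  shows "((\<lambda>t. fst (\<phi> t)) has_real_derivative snd (\<phi> t) - (fst (\<phi> t))\<^sup>2) (at t within I)"
    and "((\<lambda>t. snd (\<phi> t)) has_real_derivative - fst (\<phi> t) * snd (\<phi> t)) (at t within I)"
proof -
  have d: "(\<phi> has_vector_derivative nf (\<phi> t)) (at t within I)"
    using assms by (simp add: solves_def)
  show "((\<lambda>t. fst (\<phi> t)) has_real_derivative snd (\<phi> t) - (fst (\<phi> t))\<^sup>2) (at t within I)"
    using bounded_linear.has_vector_derivative[OF bounded_linear_fst d]
    by (simp add: has_real_derivative_iff_has_vector_derivative nf_def case_prod_beta)
  show "((\<lambda>t. snd (\<phi> t)) has_real_derivative - fst (\<phi> t) * snd (\<phi> t)) (at t within I)"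
    using bounded_linear.has_vector_derivative[OF bounded_linear_snd d]
    by (simp add: has_real_derivative_iff_has_vector_derivative nf_def case_prod_beta)
qed

lemma solves_subset: "solves X \<phi> I \<Longrightarrow> J \<subseteq> I \<Longrightarrow> solves X \<phi> J"
  unfolding solves_def by (blast intro: has_vector_derivative_within_subset)

lemma solves_continuous_on: "solves X \<phi> I \<Longrightarrow> continuous_on I \<phi>"
  unfolding solves_def continuous_on_eq_continuous_within
  by (blast intro: has_vector_derivative_continuous)

text \<open>Along any solution \<open>pencil c\<close> is differentiated to
  \<open>- 2 * fst (\<phi> t)\<close> times itself.\<close>

lemma pencil_sign_invariant:
  assumes "0 \<le> T" "solves nf \<phi> {0..T}"
  shows "sgn (pencil c (\<phi> T)) = sgn (pencil c (\<phi> 0))"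
proof -
  have "((\<lambda>t. pencil c (\<phi> t)) has_vector_derivative - 2 * fst (\<phi> t) * pencil c (\<phi> t)) (at t within {0..T})"
    if "t \<in> {0..T}" for t
    unfolding pencil_def has_real_derivative_iff_has_vector_derivative[symmetric]
    by (auto intro!: derivative_eq_intros solves_nf_derivatives[OF assms(2) that]
        simp: field_simps power2_eq_square)
  moreover have "continuous_on {0..T} (\<lambda>t. - 2 * fst (\<phi> t))"
    using solves_continuous_on[OF assms(2)] by (intro continuous_intros)
  ultimately have "pencil c (\<phi> T) = pencil c (\<phi> 0) * exp (integral {0..T} (\<lambda>t. - 2 * fst (\<phi> t)))"
    by (rule linear_ode[OF assms(1)])
  then show ?thesis by (simp add: sgn_mult)
qed

text \<open>An orbit below the axis stays there, so \<open>x = u / v\<close> and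
  \<open>w = 1 / v\<close> are defined along it and satisfy \<open>x' = 1\<close>,
  \<open>w' = x\<close>. Then \<open>w\<close> is quadratic in time with leading coefficient
  \<open>1/2\<close> and becomes positive, although \<open>v\<close> is negative.\<close>

lemma no_global_orbit_below:
  assumes sol: "solves nf \<phi> {0..}" and "snd (\<phi> 0) < 0"
  shows False
proof -
  note d = solves_nf_derivatives[OF sol]
  have neg: "snd (\<phi> t) < 0" if "t \<ge> 0" for t
  proof -
    have sol': "solves nf \<phi> {0..t}" using sol by (rule solves_subset) auto
    have "((\<lambda>t. snd (\<phi> t)) has_vector_derivative - fst (\<phi> s) * snd (\<phi> s)) (at s within {0..t})"
      if "s \<in> {0..t}" for s
      using solves_nf_derivatives(2)[OF sol' that] by (simp add: has_real_derivative_iff_has_vector_derivative)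
    moreover have "continuous_on {0..t} (\<lambda>t. - fst (\<phi> t))"
      using solves_continuous_on[OF sol'] by (intro continuous_intros)
    ultimately have "snd (\<phi> t) = snd (\<phi> 0) * exp (integral {0..t} (\<lambda>t. - fst (\<phi> t)))"
      by (rule linear_ode[OF that])
    then show ?thesis using assms(2) by (simp add: mult_neg_pos)
  qed
  define x where "x t = fst (\<phi> t) / snd (\<phi> t)" for t
  have x: "(x has_real_derivative 1) (at t within {0..})" if "t \<in> {0..}" for t
    unfolding x_def using neg[of t] that
    by (auto intro!: derivative_eq_intros d simp: field_simps power2_eq_square)
  have "((\<lambda>t. x t - t) has_vector_derivative 0) (at t within {0..})" if "t \<in> {0..}" for t
    unfolding has_real_derivative_iff_has_vector_derivative[symmetric]
    by (auto intro!: derivative_eq_intros x that)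
  then obtain x0 where x0: "\<And>t. t \<in> {0..} \<Longrightarrow> x t - t = x0"
    using has_vector_derivative_zero_constant[of "{0..}" "\<lambda>t. x t - t"] by auto
  define w where "w t = 1 / snd (\<phi> t)" for t
  have w: "(w has_real_derivative x t) (at t within {0..})" if "t \<in> {0..}" for t
    unfolding w_def x_def using neg[of t] that
    by (auto intro!: derivative_eq_intros d simp: field_simps power2_eq_square)
  have "((\<lambda>t. w t - x0 * t - t\<^sup>2 / 2) has_vector_derivative 0) (at t within {0..})"
    if t: "t \<in> {0..}" for t
    unfolding has_real_derivative_iff_has_vector_derivative[symmetric]
    using x0[OF t] by (auto intro!: derivative_eq_intros w t simp: algebra_simps)
  then obtain w0 where w0: "\<And>t. t \<in> {0..} \<Longrightarrow> w t - x0 * t - t\<^sup>2 / 2 = w0"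
    using has_vector_derivative_zero_constant[of "{0..}" "\<lambda>t. w t - x0 * t - t\<^sup>2 / 2"] by auto
  have "eventually (\<lambda>t. w0 + x0 * t + t\<^sup>2 / 2 > 0) at_top" by real_asymp
  then obtain t where "t \<ge> 0" "w0 + x0 * t + t\<^sup>2 / 2 > 0"
    using eventually_happens'[OF _ eventually_conj[OF eventually_ge_at_top[of 0]]] by force
  moreover have "w t < 0" using neg \<open>t \<ge> 0\<close> by (simp add: w_def)
  ultimately show False using w0[of t] by simp
qed


section \<open>The bounding circle\<close>

text \<open>Completing the square in \<open>v\<close> shows that stretching the first coordinate by
  \<open>sqrt (2 * c)\<close> maps the circle with centre \<open>(0, m)\<close> and radius
  \<open>r\<close> onto the level curve, and the ball onto the sublevel set.\<close>

lemma inside_pencil: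
  assumes "c > 0" "e \<ge> 0"
  shows "inside {z. pencil c z = e} = {z. pencil c z < e}"
proof -
  define m where "m = 1 / (2 * c)"
  define r where "r = sqrt (e / c + m\<^sup>2)"
  define A :: "real \<times> real \<Rightarrow> real \<times> real" where "A z = (sqrt (2 * c) * fst z, snd z)" for z
  have lin: "linear A" by (rule linearI) (auto simp: A_def algebra_simps)
  have inj: "inj A" using assms by (auto simp: A_def inj_def)
  have surj: "surj A" using lin inj by (rule eucl.linear_inj_imp_surj)
  have sq: "e / c + m\<^sup>2 > 0" using assms by (auto simp: m_def intro: add_nonneg_pos)
  have dist: "dist (0, m) z = sqrt ((fst z)\<^sup>2 + (snd z - m)\<^sup>2)" for z :: "real \<times> real"
    by (cases z) (simp add: dist_Pair_Pair dist_real_def power2_commute)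
  have pencil: "pencil c (A z) = c * ((fst z)\<^sup>2 + (snd z - m)\<^sup>2 - m\<^sup>2)" for z
    using assms by (simp add: pencil_def A_def m_def power_mult_distrib field_simps power2_eq_square)
  have eq: "pencil c (A z) = e \<longleftrightarrow> z \<in> sphere (0, m) r" for z
    using assms by (auto simp: pencil dist r_def field_simps)
  have lt: "pencil c (A z) < e \<longleftrightarrow> z \<in> ball (0, m) r" for z
    using assms by (auto simp: pencil dist r_def field_simps)
  have image: "{z. P z} = A ` {z. P (A z)}" for P
    using surj by (auto simp: image_iff) (metis surjD prod.collapse)
  have "inside (sphere (0 :: real, m) r) = ball (0, m) r"
    using inside_frontier_eq_interior[of "cball (0 :: real, m) r"] by simp
  then show ?thesis
    unfolding image[of "\<lambda>z. pencil c z = e"] image[of "\<lambda>z. pencil c z < e"] eq lt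
    using inside_injective_linear_image[OF lin inj, of "sphere (0, m) r"]
    by (simp only: Collect_mem_eq)
qed

text \<open>The circle with centre \<open>(0, 1)\<close> and radius 2, starting at its top
  \<open>(0, 3)\<close>. The bottom \<open>(0, - 1)\<close> belongs to \<open>s = 1/2\<close>, and
  the horizontal axis is met where the cosine is \<open>- 1/2\<close>, that is at
  \<open>s = 1/3\<close> and \<open>s = 2/3\<close>.\<close>

definition circ :: "real \<Rightarrow> real \<times> real" where
  "circ s = (2 * sin (2 * pi * s), 1 + 2 * cos (2 * pi * s))"

lemma pencil_half: "pencil (1/2) z = ((fst z)\<^sup>2 + (snd z - 1)\<^sup>2 - 1) / 2"
  by (simp add: pencil_def field_simps power2_eq_square)

lemma dist_centre: "dist (0, 1) z = sqrt (2 * pencil (1/2) z + 1)"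
  by (cases z) (simp add: dist_Pair_Pair dist_real_def power2_commute pencil_half field_simps)

lemma ball_pencil: "ball (0, 1) 2 = {z. pencil (1/2) z < 3/2}"
  and cball_pencil: "cball (0, 1) 2 = {z. pencil (1/2) z \<le> 3/2}"
proof -
  have "sqrt (2 * x + 1) < 2 \<longleftrightarrow> x < 3/2" "sqrt (2 * x + 1) \<le> 2 \<longleftrightarrow> x \<le> 3/2" for x :: real
    using real_sqrt_less_iff[of "2 * x + 1" 4] real_sqrt_le_iff[of "2 * x + 1" 4] by auto
  then show "ball (0, 1) 2 = {z. pencil (1/2) z < 3/2}" "cball (0, 1) 2 = {z. pencil (1/2) z \<le> 3/2}"
    by (auto simp: dist_centre)
qed

lemma pencil_circ [simp]: "pencil (1/2) (circ s) = 3/2"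
  by (simp add: pencil_half circ_def power_mult_distrib flip: distrib_left)

lemma circ_parameter:
  assumes "pencil (1/2) z = 3/2"
  obtains s where "0 \<le> s" "s < 1" "z = circ s"
proof -
  have "(fst z / 2)\<^sup>2 + ((snd z - 1) / 2)\<^sup>2 = 1"
    using assms by (simp add: pencil_half field_simps)
  then have "((snd z - 1) / 2)\<^sup>2 + (fst z / 2)\<^sup>2 = 1" by simp
  then obtain t where "0 \<le> t" "t < 2 * pi" "(snd z - 1) / 2 = cos t" "fst z / 2 = sin t"
    using sincos_total_2pi by metis
  then show ?thesis
    by (intro that[of "t / (2 * pi)"]) (auto simp: circ_def prod_eq_iff)
qed

lemma range_circ: "range circ = {z. pencil (1/2) z = 3/2}"
proof (intro equalityI subsetI)
  fix z assume "z \<in> {z. pencil (1/2) z = 3/2}"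
  then obtain s where "z = circ s" using circ_parameter by blast
  then show "z \<in> range circ" by simp
qed auto

lemma inside_circ: "inside (range circ) = {z. pencil (1/2) z < 3/2}"
  unfolding range_circ by (rule inside_pencil) auto

lemma disc_circ: "disc circ = {z. pencil (1/2) z \<le> 3/2}"
  unfolding disc_def inside_circ unfolding range_circ by auto

lemma circ_plus_1: "circ (s + 1) = circ s"
  by (simp add: circ_def distrib_left)

lemma circ_has_vector_derivative:
  "(circ has_vector_derivative (4 * pi * cos (2 * pi * s), - 4 * pi * sin (2 * pi * s))) (at s)"
proof -
  have "((\<lambda>s. (2 * sin (2 * pi * s), 1 + 2 * cos (2 * pi * s))) has_vector_derivative
      (4 * pi * cos (2 * pi * s), - 4 * pi * sin (2 * pi * s))) (at s)"
    by (intro has_vector_derivative_Pair;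
        unfold has_real_derivative_iff_has_vector_derivative[symmetric];
        auto intro!: derivative_eq_intros)
  then show ?thesis by (simp add: circ_def[abs_def])
qed

lemma vector_derivative_circ:
  "vector_derivative circ (at s) = (2 * pi * (snd (circ s) - 1), - 2 * pi * fst (circ s))"
  using vector_derivative_at[OF circ_has_vector_derivative] by (simp add: circ_def)

lemma jordan_C1_circ: "jordan_C1 circ"
  unfolding jordan_C1_def
proof (intro conjI allI)
  show "circ C1_differentiable_on UNIV"
    unfolding C1_differentiable_on_def
    by (intro exI[of _ "\<lambda>s. (4 * pi * cos (2 * pi * s), - 4 * pi * sin (2 * pi * s))"] conjI ballI
        circ_has_vector_derivative continuous_intros)
  show "vector_derivative circ (at s) \<noteq> 0" for s
    using sin_zero_norm_cos_one[of "2 * pi * s"]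
    by (auto simp: vector_derivative_circ circ_def zero_prod_def)
  show "inj_on circ {0..<1}"
  proof (rule inj_onI)
    fix s t :: real assume st: "s \<in> {0..<1}" "t \<in> {0..<1}" "circ s = circ t"
    then have "sin (2 * pi * s) = sin (2 * pi * t) \<and> cos (2 * pi * s) = cos (2 * pi * t)"
      by (simp add: circ_def)
    then obtain n where "2 * pi * s = 2 * pi * t + 2 * pi * of_int n"
      using sin_cos_eq_iff by blast
    then have "2 * pi * s = 2 * pi * (t + of_int n)" by (simp add: distrib_left)
    then have "s = t + of_int n" by simp
    moreover from this st have "n = 0" by auto
    ultimately show "s = t" by simp
  qed
qed (rule circ_plus_1)

lemma snd_circ_pos: "snd (circ s) > 0" if "\<bar>s\<bar> < 1/3"
proof -
  have "cos (2 * pi / 3) < cos \<bar>2 * pi * s\<bar>"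
    using that by (intro cos_monotone_0_pi) (auto simp: abs_mult field_simps)
  then show ?thesis by (simp add: circ_def cos_120)
qed

lemma snd_circ_neg: "snd (circ s) < 0" if "1/3 < s" "s < 2/3"
proof -
  have "pi * (2 * \<bar>1/2 - s\<bar>) < pi * (1 / 3)"
    using that by (intro mult_strict_left_mono) (auto simp: abs_if)
  then have "cos (pi / 3) < cos \<bar>2 * pi * (1/2 - s)\<bar>"
    by (intro cos_monotone_0_pi) (auto simp: abs_mult)
  then have "1 / 2 < cos (pi - 2 * pi * s)" by (simp add: cos_60 algebra_simps)
  then show ?thesis by (simp add: circ_def)
qed

lemma fst_circ_pos: "fst (circ s) > 0" if "0 < s" "s < 1/2"
  using that sin_gt_zero[of "2 * pi * s"] by (simp add: circ_def)

lemma fst_circ_neg: "fst (circ s) < 0" if "-1/2 < s \<and> s < 0 \<or> 1/2 < s \<and> s < 1"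
proof -
  have *: "fst (circ s) < 0" if "-1/2 < s" "s < 0" for s
    using that sin_gt_zero[of "- (2 * pi * s)"] mult_strict_left_mono[of "- s" "1/2" "2 * pi"]
    by (simp add: circ_def mult_pos_neg)
  from that show ?thesis
  proof
    assume "1/2 < s \<and> s < 1"
    then show ?thesis using *[of "s - 1"] circ_plus_1[of "s - 1"] by simp
  qed (simp add: *)
qed

lemma circ_thirds:
  "circ (1/3) = (sqrt 3, 0)" "circ (- (1/3)) = (- sqrt 3, 0)" "circ (2/3) = (- sqrt 3, 0)"
proof -
  show 1: "circ (1/3) = (sqrt 3, 0)" "circ (- (1/3)) = (- sqrt 3, 0)"
    by (simp_all add: circ_def sin_120 cos_120)
  then show "circ (2/3) = (- sqrt 3, 0)" using circ_plus_1[of "- (1/3)"] by simp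
qed

lemma upper_arc: "circ ` {-1/3..1/3} = {z. pencil (1/2) z = 3/2 \<and> 0 \<le> snd z}"
proof (intro equalityI subsetI)
  fix z assume "z \<in> circ ` {-1/3..1/3}"
  then obtain s where s: "z = circ s" "-1/3 \<le> s" "s \<le> 1/3" by auto
  then have "\<bar>s\<bar> < 1/3 \<or> s = 1/3 \<or> s = - (1/3)" by auto
  then have "0 \<le> snd (circ s)"
    using snd_circ_pos[of s] by (elim disjE) (simp_all only: circ_thirds, simp_all)
  then show "z \<in> {z. pencil (1/2) z = 3/2 \<and> 0 \<le> snd z}" by (simp add: s(1))
next
  fix z assume z: "z \<in> {z. pencil (1/2) z = 3/2 \<and> 0 \<le> snd z}"
  then obtain s where s: "0 \<le> s" "s < 1" "z = circ s" using circ_parameter by blast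
  have "s \<le> 1/3 \<or> 2/3 \<le> s" using z s snd_circ_neg[of s] by force
  \<comment> \<open>Parameters from \<open>2/3\<close> on are moved back by one period.\<close>
  then show "z \<in> circ ` {-1/3..1/3}"
    using s circ_plus_1[of "s - 1"]
    by (auto intro: image_eqI[of _ _ s] image_eqI[of _ _ "s - 1"])
qed

lemma lower_arc: "circ ` {1/3..2/3} = {z. pencil (1/2) z = 3/2 \<and> snd z \<le> 0}"
proof (intro equalityI subsetI)
  fix z assume "z \<in> circ ` {1/3..2/3}"
  then obtain s where s: "z = circ s" "1/3 \<le> s" "s \<le> 2/3" by auto
  then have "1/3 < s \<and> s < 2/3 \<or> s = 1/3 \<or> s = 2/3" by auto
  then have "snd (circ s) \<le> 0"
    using snd_circ_neg[of s] by (elim disjE) (simp_all only: circ_thirds, simp_all)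
  then show "z \<in> {z. pencil (1/2) z = 3/2 \<and> snd z \<le> 0}" by (simp add: s(1))
next
  fix z assume z: "z \<in> {z. pencil (1/2) z = 3/2 \<and> snd z \<le> 0}"
  then obtain s where s: "0 \<le> s" "s < 1" "z = circ s" using circ_parameter by blast
  have "\<not> s < 1/3" using z s snd_circ_pos[of s] by force
  moreover have "\<not> 2/3 < s" using z s snd_circ_pos[of "s - 1"] circ_plus_1[of "s - 1"] by force
  ultimately show "z \<in> circ ` {1/3..2/3}"
    using s by (auto intro: image_eqI[of _ _ s])
qed

section \<open>Direction of the field on the circle\<close>

text \<open>The assumption says that the field has negative inner product with the outward radius. A
  tangent or vanishing field would make this product zero.\<close>

lemma inward_circ:
  assumes "fst (X (circ s)) * fst (circ s) + snd (X (circ s)) * (snd (circ s) - 1) < 0"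
  shows "inward X circ s"
proof -
  obtain u v where uv: "circ s = (u, v)" by force
  obtain a b where ab: "X (u, v) = (a, b)" by force
  define k where "k = a * u + b * (v - 1)"
  have k: "k < 0" using assms by (simp add: ab uv k_def)
  have uv1: "u\<^sup>2 + (v - 1)\<^sup>2 = 4"
    using pencil_circ[of s] by (simp add: uv pencil_half)
  have "\<not> tangent_at X circ s"
  proof
    assume "tangent_at X circ s"
    then consider "(a, b) = 0" | "(2 * pi * (v - 1), - 2 * pi * u) = 0"
      | c where "(2 * pi * (v - 1), - 2 * pi * u) = c *\<^sub>R (a, b)"
      unfolding tangent_at_def collinear_lemma vector_derivative_circ ab uv by auto
    then show False
    proof cases
      case (3 c)
      then have "2 * pi * (v - 1) = c * a" "2 * pi * u = - (c * b)" by auto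
      moreover have "2 * pi * k = a * (2 * pi * u) + b * (2 * pi * (v - 1))"
        by (simp add: k_def algebra_simps)
      ultimately have "2 * pi * k = 0" by simp
      then show False using k by simp
    qed (use k uv1 in \<open>auto simp: k_def zero_prod_def\<close>)
  qed
  \<comment> \<open>Along the segment, twice \<open>pencil (1/2)\<close> is
    \<open>3 + t * (2 * k + t * (a^2 + b^2))\<close>, which is below 3 for small positive
    \<open>t\<close> since \<open>k < 0\<close>. The summand 1 in the bound makes its denominator
    visibly positive.\<close>
  moreover have "circ s + t *\<^sub>R X (circ s) \<in> inside (range circ)"
    if t: "0 < t" "t < - 2 * k / (a\<^sup>2 + b\<^sup>2 + 1)" for t
  proof -
    have "a\<^sup>2 + b\<^sup>2 + 1 > 0" by (simp add: add_nonneg_pos)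
    then have "t * (a\<^sup>2 + b\<^sup>2 + 1) < - 2 * k"
      using t(2) by (simp only: pos_less_divide_eq)
    then have "2 * k + t * (a\<^sup>2 + b\<^sup>2) < 0" using t by (simp add: distrib_left)
    then have "t * (2 * k + t * (a\<^sup>2 + b\<^sup>2)) < 0" using t by (simp add: mult_pos_neg)
    moreover have "2 * pencil (1/2) (u + t * a, v + t * b) = 3 + t * (2 * k + t * (a\<^sup>2 + b\<^sup>2))"
      using uv1 by (simp add: pencil_half k_def field_simps power2_eq_square)
    ultimately show ?thesis by (simp add: inside_circ ab uv)
  qed
  moreover have "- 2 * k / (a\<^sup>2 + b\<^sup>2 + 1) > 0"
    using k by (intro divide_pos_pos) (auto intro: add_nonneg_pos)
  ultimately show ?thesis unfolding inward_def by blast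
qed

text \<open>The product is \<open>u * (1 - R^2)\<close>, where \<open>R\<close> is the distance from
  the centre, and \<open>R = 2\<close> on the circle. Its sign is therefore decided by the side of
  the vertical axis.\<close>

lemma radial_component_nf:
  "fst (nf (circ s)) * fst (circ s) + snd (nf (circ s)) * (snd (circ s) - 1) = - 3 * fst (circ s)"
proof -
  obtain u v where uv: "circ s = (u, v)" by force
  have uv1: "u\<^sup>2 + (v - 1)\<^sup>2 = 4"
    using pencil_circ[of s] by (simp add: uv pencil_half)
  have "(v - u\<^sup>2) * u + - u * v * (v - 1) = u * (1 - (u\<^sup>2 + (v - 1)\<^sup>2))"
    by (simp add: algebra_simps power2_eq_square)
  then show ?thesis unfolding uv1 by (simp add: uv nf_def)
qed

lemma inward_nf: "fst (circ s) > 0 \<Longrightarrow> inward nf circ s"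
  by (rule inward_circ) (simp only: radial_component_nf)

lemma outward_nf: "fst (circ s) < 0 \<Longrightarrow> outward nf circ s"
  using radial_component_nf[of s] by (intro inward_circ) simp

text \<open>For \<open>\<sigma> = - 1\<close> this is an orbit in reversed time.\<close>

definition axis_orbit :: "real \<Rightarrow> real \<Rightarrow> real \<times> real" where
  "axis_orbit \<sigma> t = (\<sigma> * sqrt 3 / (1 + sqrt 3 * t), 0)"

section \<open>The characteristic orbits on the horizontal axis\<close>

lemma axis_orbit_flow: "axis_orbit 1 = flow (sqrt 3, 0)"
  "axis_orbit (- 1) = (\<lambda>t. (- fst (flow (sqrt 3, 0) t), snd (flow (sqrt 3, 0) t)))"
  by (auto simp: axis_orbit_def flow_def den_def)

lemma image_axis_orbit:
  assumes "\<sigma> \<in> {1, - 1}"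
  shows "axis_orbit \<sigma> ` {0..} = {z. snd z = 0 \<and> 0 < \<sigma> * fst z \<and> \<sigma> * fst z \<le> sqrt 3}" (is "_ = ?R")
proof (intro equalityI subsetI)
  fix z assume "z \<in> axis_orbit \<sigma> ` {0..}"
  then obtain t where t: "t \<ge> 0" "z = axis_orbit \<sigma> t" by auto
  have "1 + sqrt 3 * t \<ge> 1" using t by simp
  moreover from this have "sqrt 3 / (1 + sqrt 3 * t) \<le> sqrt 3"
    by (simp add: divide_le_eq mult_le_cancel_left1)
  moreover have "\<sigma> * \<sigma> = 1" using assms by auto
  moreover from \<open>1 + sqrt 3 * t \<ge> 1\<close> have "0 < sqrt 3 / (1 + sqrt 3 * t)" by simp
  ultimately show "z \<in> ?R"
    using t by (simp add: axis_orbit_def mult.assoc[symmetric])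
next
  fix z assume z: "z \<in> ?R"
  define x where "x = \<sigma> * fst z"
  have x: "0 < x" "x \<le> sqrt 3" using z by (auto simp: x_def)
  \<comment> \<open>The time comes from solving \<open>x = sqrt 3 / (1 + sqrt 3 * t)\<close> for
    \<open>t\<close>.\<close>
  have "1 + sqrt 3 * (1 / x - 1 / sqrt 3) = sqrt 3 / x" by (simp add: right_diff_distrib)
  then have "axis_orbit \<sigma> (1 / x - 1 / sqrt 3) = (\<sigma> * x, 0)" using x by (simp add: axis_orbit_def)
  also have "\<dots> = z" using z assms by (auto simp: x_def prod_eq_iff)
  finally show "z \<in> axis_orbit \<sigma> ` {0..}"
    using x by (intro image_eqI[of _ _ "1 / x - 1 / sqrt 3"]) (auto simp: frac_le)
qed

lemma characteristic_axis_orbit: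
  assumes "\<sigma> \<in> {1, - 1}"
  shows "characteristic nf (0, 0) circ (axis_orbit \<sigma>)"
proof -
  have pos: "solves nf (axis_orbit 1) {0..}"
    unfolding axis_orbit_flow by (rule solves_flow) (auto simp: den_def add_nonneg_eq_0_iff)
  have neg: "solves (- nf) (axis_orbit (- 1)) {0..}"
    using reflection.solves[OF pos] by (simp add: axis_orbit_flow atLeast_def)
  have "(axis_orbit \<sigma> \<longlongrightarrow> (0, 0)) at_top"
    unfolding axis_orbit_def
  proof (rule tendsto_Pair)
    have "((\<lambda>t. \<sigma> * (sqrt 3 / (1 + sqrt 3 * t))) \<longlongrightarrow> \<sigma> * 0) at_top"
      by (intro tendsto_mult tendsto_const) real_asymp
    then show "((\<lambda>t. \<sigma> * sqrt 3 / (1 + sqrt 3 * t)) \<longlongrightarrow> 0) at_top" by simp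
  qed simp
  moreover have "axis_orbit \<sigma> t \<in> inside (range circ)" if "t > 0" for t
  proof -
    have "(\<sigma> * sqrt 3 / (1 + sqrt 3 * t))\<^sup>2 = 3 / (1 + sqrt 3 * t)\<^sup>2"
      using assms by (auto simp: power_divide)
    also have "\<dots> < 3" using that by (simp add: divide_less_eq one_less_power)
    finally show ?thesis by (simp add: inside_circ pencil_def axis_orbit_def)
  qed
  moreover have "axis_orbit \<sigma> 0 \<in> range circ"
    using assms by (auto simp: range_circ pencil_def axis_orbit_def)
  ultimately show ?thesis
    unfolding characteristic_def using pos neg assms by auto
qed

lemma axis_orbits:
  "{(0, 0)} \<union> axis_orbit 1 ` {0..} \<union> axis_orbit (- 1) ` {0..}
    = {z. pencil (1/2) z \<le> 3/2 \<and> snd z = 0}"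
proof -
  have abs: "x\<^sup>2 \<le> 3 \<longleftrightarrow> \<bar>x\<bar> \<le> sqrt 3" for x :: real
    using real_sqrt_le_iff[of "x\<^sup>2" 3] by simp
  have "axis_orbit 1 ` {0..} = {z. snd z = 0 \<and> 0 < fst z \<and> fst z \<le> sqrt 3}"
    "axis_orbit (- 1) ` {0..} = {z. snd z = 0 \<and> fst z < 0 \<and> - fst z \<le> sqrt 3}"
    using image_axis_orbit[of 1] image_axis_orbit[of "- 1"] by auto
  then show ?thesis
    by (simp only:) (auto simp: pencil_def abs abs_if prod_eq_iff split: if_splits)
qed

section \<open>The two halves of the disc as sectors\<close>

text \<open>Orbits, origin and arc together form the frontier of the bounded convex set
  \<open>K\<close>, and the inside of such a frontier is the interior. The sign \<sigma> selects the
  half, \<tau> the order of the two orbits.\<close>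

lemma sector_half_disc:
  assumes "\<sigma> \<in> {1, - 1}" "\<tau> \<in> {1, - 1}"
    and arc: "circ ` {s..s'} = {z. pencil (1/2) z = 3/2 \<and> 0 \<le> \<sigma> * snd z}"
  shows "sector (0, 0) circ s s' (axis_orbit \<tau>) (axis_orbit (- \<tau>))
    = {z. pencil (1/2) z \<le> 3/2 \<and> 0 \<le> \<sigma> * snd z}"
proof -
  let ?B = "{(0, 0)} \<union> axis_orbit \<tau> ` {0..} \<union> axis_orbit (- \<tau>) ` {0..} \<union> circ ` {s..s'}"
  define K where "K = cball (0, 1) 2 \<inter> {z. (0 :: real, \<sigma>) \<bullet> z \<ge> 0}"
  have K: "K = {z. pencil (1/2) z \<le> 3/2 \<and> 0 \<le> \<sigma> * snd z}"
    by (auto simp: K_def cball_pencil)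
  have "(0 :: real, \<sigma>) \<noteq> 0" using assms(1) by (auto simp: zero_prod_def)
  then have int: "interior K = {z. pencil (1/2) z < 3/2 \<and> 0 < \<sigma> * snd z}"
    by (auto simp: K_def interior_Int ball_pencil)
  have "closed K" unfolding K_def by (intro closed_Int closed_cball closed_halfspace_ge)
  then have "frontier K = {z. pencil (1/2) z \<le> 3/2 \<and> 0 \<le> \<sigma> * snd z
      \<and> (pencil (1/2) z = 3/2 \<or> snd z = 0)}"
    unfolding frontier_def int using assms(1) by (auto simp: K)
  moreover have "?B = {z. pencil (1/2) z \<le> 3/2 \<and> 0 \<le> \<sigma> * snd z
      \<and> (pencil (1/2) z = 3/2 \<or> snd z = 0)}"
  proof -
    have "{(0, 0)} \<union> axis_orbit \<tau> ` {0..} \<union> axis_orbit (- \<tau>) ` {0..}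
        = {(0, 0)} \<union> axis_orbit 1 ` {0..} \<union> axis_orbit (- 1) ` {0..}"
      using assms(2) by auto
    then show ?thesis unfolding arc axis_orbits by auto
  qed
  ultimately have B: "?B = frontier K" by simp
  have "inside (frontier K) = interior K"
    unfolding K_def by (intro inside_frontier_eq_interior convex_Int convex_cball
        convex_halfspace_ge bounded_Int disjI1 bounded_cball)
  then have "sector (0, 0) circ s s' (axis_orbit \<tau>) (axis_orbit (- \<tau>)) = frontier K \<union> interior K"
    unfolding sector_def Let_def B by simp
  also have "\<dots> = K" using \<open>closed K\<close> by (auto simp: frontier_def closure_closed interior_subset[THEN subsetD])
  finally show ?thesis by (simp only: K)
qed

lemma upper_sector:
  "sector (0, 0) circ (-1/3) (1/3) (axis_orbit (- 1)) (axis_orbit 1)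
    = {z. pencil (1/2) z \<le> 3/2 \<and> 0 \<le> snd z}"
  using sector_half_disc[of 1 "- 1" "-1/3" "1/3"] upper_arc by simp

lemma lower_sector:
  "sector (0, 0) circ (1/3) (2/3) (axis_orbit 1) (axis_orbit (- 1))
    = {z. pencil (1/2) z \<le> 3/2 \<and> snd z \<le> 0}"
  using sector_half_disc[of "- 1" 1 "1/3" "2/3"] lower_arc by simp

lemma reflect_pencil [simp]: "pencil c (- x, y) = pencil c (x, y)"
  by (simp add: pencil_def)

lemma image_reflect_pencil:
  "(\<lambda>z. (- fst z, snd z)) ` {z. pencil c z = e} = {z. pencil c z = e}"
proof (intro equalityI subsetI)
  fix z assume "z \<in> {z. pencil c z = e}"
  then show "z \<in> (\<lambda>z. (- fst z, snd z)) ` {z. pencil c z = e}"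
    by (intro image_eqI[of _ _ "(- fst z, snd z)"]) auto
qed auto

text \<open>\<open>pencil\<close> is even in the first coordinate, so the time-reversing reflection
  preserves its level curves.\<close>

lemma meets_backwards:
  assumes "meets nf (- fst z, snd z) {z. pencil c z = e}"
  shows "meets (- nf) z {z. pencil c z = e}"
  using reflection.meets[OF assms] by (simp add: image_reflect_pencil)

text \<open>Identifies the orbit through the top of the circle with an ellipse, so that
  \<open>inside_pencil\<close> describes the region it bounds.\<close>

lemma loop:
  "insert (0, 0) (range (flow (0, 3))) = {z. pencil (1/3) z = 0}"
proof (intro equalityI subsetI)
  fix z assume "z \<in> insert (0, 0) (range (flow (0, 3)))"
  then consider "z = (0, 0)" | t where "z = flow (0, 3) t" by auto
  then show "z \<in> {z. pencil (1/3) z = 0}"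
  proof cases
    case 2
    have "den (0, 3) t > 0" by (simp add: den_def add_pos_nonneg)
    then show ?thesis using 2 by (simp add: pencil_flow) (simp add: pencil_def power2_eq_square)
  qed (simp add: pencil_def)
next
  fix z assume "z \<in> {z. pencil (1/3) z = 0}"
  moreover obtain u v where z: "z = (u, v)" by force
  ultimately have uv: "3 * u\<^sup>2 = 6 * v - 2 * v\<^sup>2" by (simp add: pencil_def field_simps)
  show "z \<in> insert (0, 0) (range (flow (0, 3)))"
  proof (cases "v = 0")
    case True
    then show ?thesis using uv z by simp
  next
    case False
    \<comment> \<open>The time is \<open>u / v\<close> because this quotient grows at unit speed and
      vanishes at \<open>(0, 3)\<close>.\<close>
    have "den (0, 3) (u / v) = 1 + 3 * u\<^sup>2 / (2 * v\<^sup>2)"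
      by (simp add: den_def power_divide)
    also have "\<dots> = 3 / v"
      unfolding uv using False by (simp add: field_simps power2_eq_square)
    finally have "flow (0, 3) (u / v) = z"
      using False by (simp add: flow_def z)
    then show ?thesis by (metis insertCI rangeI)
  qed
qed

section \<open>The sectors of the normal form\<close>

text \<open>The ellipse through the top separates two kinds of orbits. Those inside it are loops;
  those outside tend to the origin on one side in time and reach the circle on the other, according
  to the half-plane they start in.\<close>

lemma elliptic_upper:
  "elliptic_sector nf (0, 0) circ (-1/3) (1/3) (axis_orbit (- 1)) (axis_orbit 1)"
proof -
  let ?\<phi> = "flow (0, 3)"
  have ins: "inside (insert (0, 0) (range ?\<phi>)) = {z. pencil (1/3) z < 0}"
    unfolding loop by (rule inside_pencil) auto
  have half: "pencil (1/2) z = pencil (1/3) z + (snd z)\<^sup>2 / 6" for z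
    by (simp add: pencil_def field_simps)
  have den: "den (0, 3) t \<ge> 1" for t by (simp add: den_def)
  have val: "pencil (1/2) (?\<phi> t) = 3/2 / (den (0, 3) t)\<^sup>2" for t
    using den[of t] by (subst pencil_flow) (auto simp: pencil_def power2_eq_square)
  \<comment> \<open>The arc runs from left to right and \<open>nf\<close> points outward on its left
    part, so the orientation \<open>- nf\<close> is the one to use.\<close>
  have 1: "\<forall>x\<in>{-1/3..<0}. inward (- nf) circ x"
    by (auto intro!: outward_nf fst_circ_neg)
  have 2: "\<forall>x\<in>{0<..1/3}. outward (- nf) circ x"
    by (auto simp: fun_Compl_def intro!: inward_nf fst_circ_pos)
  \<comment> \<open>At the top the field \<open>- nf\<close> is \<open>(- 3, 0)\<close> and the
    tangent is \<open>(4 * pi, 0)\<close>.\<close>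
  have 3: "tangent_at (- nf) circ 0"
    unfolding tangent_at_def collinear_lemma vector_derivative_circ
    by (auto simp: circ_def nf_def zero_prod_def intro: exI[of _ "- 4 * pi / 3"])
  have hom: "homoclinic nf (0, 0) ?\<phi>"
    unfolding homoclinic_def using flow_tendsto_0[of "(0, 3)"] den
    by (auto intro!: solves_flow) (metis not_one_le_zero)
  have start: "?\<phi> 0 = circ 0" by (simp add: circ_def)
  have interior: "?\<phi> t \<in> inside (range circ)" if "t \<noteq> 0" for t
  proof -
    have "den (0, 3) t > 1" using that by (simp add: den_def)
    then have "(den (0, 3) t)\<^sup>2 > 1" by (simp add: one_less_power)
    then show ?thesis unfolding inside_circ by (simp add: val divide_less_eq)
  qed
  have sub: "range ?\<phi> \<subseteq> {z. pencil (1/2) z \<le> 3/2 \<and> 0 \<le> snd z}"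
  proof -
    have "pencil (1/2) (?\<phi> t) \<le> 3/2" "0 \<le> snd (?\<phi> t)" for t
      using den[of t] one_le_power[OF den[of t], of 2] unfolding val
      by (simp_all add: flow_def divide_le_eq)
    then show ?thesis by auto
  qed
  have loops: "\<exists>\<psi>. homoclinic nf (0, 0) \<psi> \<and> \<psi> 0 = q \<and> range \<psi> \<subseteq> disc circ"
    if "pencil (1/3) q < 0" for q
  proof (intro exI[of _ "flow q"] conjI)
    show "range (flow q) \<subseteq> disc circ"
    proof
      fix z assume "z \<in> range (flow q)"
      then obtain t where t: "z = flow q t" by auto
      have "den q t > 0" using homoclinic_flow(2)[OF that] by simp
      then have neg: "pencil (1/3) z \<le> 0"
        using that unfolding t by (simp add: pencil_flow divide_nonpos_pos)
      \<comment> \<open>On and inside the ellipse the second coordinate lies between 0 and 3, so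
        \<open>pencil (1/2)\<close> exceeds \<open>pencil (1/3)\<close> by at most
        \<open>9/6 = 3/2\<close>, which keeps the loop in the disc.\<close>
      have "snd z * (snd z - 3) = 3 * pencil (1/3) z - 3/2 * (fst z)\<^sup>2"
        by (simp add: pencil_def field_simps power2_eq_square)
      also have "\<dots> \<le> 0" using neg zero_le_power2[of "fst z"] by linarith
      finally have "snd z * (snd z - 3) \<le> 0" .
      then have "0 \<le> snd z" "snd z \<le> 3" by (auto simp: mult_le_0_iff)
      then have "(snd z)\<^sup>2 \<le> 3\<^sup>2" by (intro power_mono) auto
      then show "z \<in> disc circ" using neg by (simp add: disc_circ half)
    qed
  qed (use that homoclinic_flow(1)[OF that] in auto)
  have rest: "tends_to_pt nf q (0, 0) \<and> meets (- nf) q (range circ) \<or>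
      tends_to_pt (- nf) q (0, 0) \<and> meets nf q (range circ)"
    if q: "pencil (1/2) q \<le> 3/2" "0 \<le> snd q" "pencil (1/3) q > 0" for q
  proof (cases "fst q \<ge> 0")
    case True
    have "q \<noteq> (0, 0)" using q(3) by (auto simp: pencil_def)
    then have "tends_to_pt nf q (0, 0)" using True q(2) by (intro tends_to_origin_right)
    moreover have "meets (- nf) q (range circ)"
      unfolding range_circ using True q by (intro meets_backwards meets_circle_left) auto
    ultimately show ?thesis by blast
  next
    case False
    then have "tends_to_pt nf (- fst q, snd q) (0, 0)"
      using q(2) by (intro tends_to_origin_right) auto
    then have "tends_to_pt (- nf) q (0, 0)"
      using reflection.tends_to_pt by fastforce
    moreover have "meets nf q (range circ)"
      unfolding range_circ using False q by (intro meets_circle_left) auto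
    ultimately show ?thesis by blast
  qed
  have "\<forall>q \<in> inside (insert (0, 0) (range ?\<phi>)).
      \<exists>\<psi>. homoclinic nf (0, 0) \<psi> \<and> \<psi> 0 = q \<and> range \<psi> \<subseteq> disc circ"
    unfolding ins using loops by blast
  moreover have "\<forall>q \<in> {z. pencil (1/2) z \<le> 3/2 \<and> 0 \<le> snd z} -
        (insert (0, 0) (range ?\<phi>) \<union> inside (insert (0, 0) (range ?\<phi>))).
      tends_to_pt nf q (0, 0) \<and> meets (- nf) q (range circ) \<or>
      tends_to_pt (- nf) q (0, 0) \<and> meets nf q (range circ)"
    unfolding ins unfolding loop using rest by force
  ultimately have 4: "\<exists>\<phi>. homoclinic nf (0, 0) \<phi> \<and> \<phi> 0 = circ 0 \<and>
           (\<forall>t. t \<noteq> 0 \<longrightarrow> \<phi> t \<in> inside (range circ)) \<and>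
           range \<phi> \<subseteq> {z. pencil (1/2) z \<le> 3/2 \<and> 0 \<le> snd z} \<and>
           (\<forall>q \<in> inside (insert (0, 0) (range \<phi>)).
              \<exists>\<psi>. homoclinic nf (0, 0) \<psi> \<and> \<psi> 0 = q \<and> range \<psi> \<subseteq> disc circ) \<and>
           (\<forall>q \<in> {z. pencil (1/2) z \<le> 3/2 \<and> 0 \<le> snd z} -
                 (insert (0, 0) (range \<phi>) \<union> inside (insert (0, 0) (range \<phi>))).
              tends_to_pt nf q (0, 0) \<and> meets (- nf) q (range circ) \<or>
              tends_to_pt (- nf) q (0, 0) \<and> meets nf q (range circ))"
    using hom start interior sub by blast
  show ?thesis
    unfolding elliptic_sector_def upper_sector
    by (intro bexI[of _ "- nf"] bexI[of _ 0] conjI 1 2 3 4) auto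
qed

text \<open>Below the axis every orbit reaches the circle forwards, and by reflection also
  backwards. The tangency at the bottom is external because \<open>den\<close> drops below 1 on both
  sides of time 0, which increases \<open>pencil (1/2)\<close>.\<close>

lemma hyperbolic_lower:
  "hyperbolic_sector nf (0, 0) circ (1/3) (2/3) (axis_orbit 1) (axis_orbit (- 1))"
proof -
  have half: "circ (1/2) = (0, - 1)" by (simp add: circ_def)
  have 1: "\<forall>x\<in>{1/3..<1/2}. inward nf circ x"
    by (auto intro!: inward_nf fst_circ_pos)
  have 2: "\<forall>x\<in>{1/2<..2/3}. outward nf circ x"
    by (auto intro!: outward_nf fst_circ_neg)
  \<comment> \<open>At the bottom the field is \<open>(- 1, 0)\<close> and the tangent is
    \<open>(- 4 * pi, 0)\<close>.\<close>
  have "tangent_at nf circ (1/2)"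
    unfolding tangent_at_def collinear_lemma vector_derivative_circ half
    by (auto simp: nf_def intro: exI[of _ "4 * pi"])
  \<comment> \<open>On this interval \<open>den\<close> is \<open>1 - t^2 / 2\<close>, hence at
    least \<open>1/2\<close>.\<close>
  moreover have "solves nf (flow (0, - 1)) {- 1..1}"
  proof (rule solves_flow)
    fix t :: real assume "t \<in> {- 1..1}"
    then have "t\<^sup>2 \<le> 1" by (simp add: abs_square_le_1 abs_le_iff)
    then show "den (0, - 1) t \<noteq> 0" by (simp add: den_def)
  qed
  moreover have "flow (0, - 1) t \<notin> disc circ" if "0 < \<bar>t\<bar>" "\<bar>t\<bar> \<le> 1" for t
  proof -
    have "t\<^sup>2 \<le> 1" "t\<^sup>2 > 0" using that by (auto simp: abs_square_le_1)
    then have den: "0 < den (0, - 1) t" "den (0, - 1) t < 1" by (auto simp: den_def)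
    then have "(den (0, - 1) t)\<^sup>2 < 1" by (simp add: power_less_one_iff)
    moreover have "pencil (1/2) (flow (0, - 1) t) = 3/2 / (den (0, - 1) t)\<^sup>2"
      using den by (subst pencil_flow) (auto simp: pencil_def)
    ultimately show ?thesis using den by (simp add: disc_circ divide_le_eq)
  qed
  ultimately have 3: "external_tangency nf circ (1/2)"
    unfolding external_tangency_def half
    by (intro conjI exI[of _ 1] exI[of _ "flow (0, - 1)"]) auto
  have 4: "meets nf q (range circ) \<and> meets (- nf) q (range circ)"
    if q: "q \<in> {z. pencil (1/2) z \<le> 3/2 \<and> snd z \<le> 0} -
      ({(0, 0)} \<union> axis_orbit 1 ` {0..} \<union> axis_orbit (- 1) ` {0..})" for q
  proof -
    have "snd q \<noteq> 0" using q unfolding axis_orbits by auto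
    then have "snd q < 0" using q by auto
    then show ?thesis
      unfolding range_circ using q
      by (intro conjI meets_backwards meets_pencil_below) auto
  qed
  show ?thesis
    unfolding hyperbolic_sector_def lower_sector
    by (intro conjI bexI[of _ nf] bexI[of _ "1/2"] ballI[OF 4] 1 2 3) auto
qed

section \<open>Excluding the opposite types; the exact counts\<close>

text \<open>At \<open>(0, 1)\<close> the function \<open>pencil (1/2)\<close> is negative and keeps
  its sign along every orbit, whereas it is \<open>3/2\<close> on the circle. That orbit never
  reaches the boundary.\<close>

lemma upper_not_hyperbolic:
  "\<not> hyperbolic_sector nf (0, 0) circ (-1/3) (1/3) (axis_orbit (- 1)) (axis_orbit 1)"
proof
  let ?q = "(0, 1) :: real \<times> real"
  have q: "pencil (1/2) ?q = - 1/2" by (simp add: pencil_def)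
  then have "?q \<in> {z. pencil (1/2) z \<le> 3/2 \<and> 0 \<le> snd z}
      - ({(0, 0)} \<union> axis_orbit (- 1) ` {0..} \<union> axis_orbit 1 ` {0..})"
    by (auto simp: axis_orbit_def)
  moreover assume "hyperbolic_sector nf (0, 0) circ (-1/3) (1/3) (axis_orbit (- 1)) (axis_orbit 1)"
  ultimately have "meets nf ?q {z. pencil (1/2) z = 3/2}"
    unfolding hyperbolic_sector_def upper_sector range_circ by blast
  then obtain \<phi> T where "0 \<le> T" "solves nf \<phi> {0..T}" "\<phi> 0 = ?q" "pencil (1/2) (\<phi> T) = 3/2"
    by (auto simp: meets_def)
  then show False using pencil_sign_invariant[of T \<phi> "1/2"] q by simp
qed

text \<open>An elliptic sector would need a loop through a point of the open lower arc, and no orbit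
  below the axis exists for all forward time.\<close>

lemma lower_not_elliptic:
  "\<not> elliptic_sector nf (0, 0) circ (1/3) (2/3) c c'"
proof
  assume "elliptic_sector nf (0, 0) circ (1/3) (2/3) c c'"
  then obtain r \<phi> where r: "r \<in> {1/3<..<2/3}" and \<phi>: "homoclinic nf (0, 0) \<phi>" "\<phi> 0 = circ r"
    unfolding elliptic_sector_def by blast
  have "snd (\<phi> 0) < 0" using snd_circ_neg[of r] r \<phi>(2) by simp
  moreover have "solves nf \<phi> {0..}"
    using \<phi>(1) solves_subset unfolding homoclinic_def by blast
  ultimately show False using no_global_orbit_below by blast
qed

text \<open>\<open>ends 0 = - 1 / 3\<close> is one period before \<open>ends 2 = 2 / 3\<close>; \<open>circ\<close> runs clockwise.\<close>

definition ends :: "nat \<Rightarrow> real" where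
  "ends i = (if i = 0 then -1/3 else real i / 3)"

definition separatrix :: "nat \<Rightarrow> real \<Rightarrow> real \<times> real" where
  "separatrix i = axis_orbit (if i = 1 then 1 else - 1)"

lemma sectorial_decomposition_nf:
  "sectorial_decomposition nf (0, 0) circ 2 ends separatrix"
proof -
  have "nf q \<noteq> 0" if "q \<noteq> (0, 0)" for q
    using that by (cases q) (auto simp: nf_def zero_prod_def)
  moreover have "nf (0, 0) = 0" by (simp add: nf_def zero_prod_def)
  moreover have "(0, 0) \<in> inside (range circ)" by (simp add: inside_circ pencil_def)
  moreover have "strict_mono_on {..2} ends" "ends 2 = ends 0 + 1" "separatrix 2 = separatrix 0"
    by (auto simp: strict_mono_on_def ends_def separatrix_def)
  moreover have "characteristic nf (0, 0) circ (separatrix i) \<and> separatrix i 0 = circ (ends i)"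
    if "i < 2" for i
    using that characteristic_axis_orbit circ_thirds
    by (auto simp: separatrix_def ends_def less_2_cases_iff axis_orbit_def)
  moreover have "hyperbolic_sector nf (0, 0) circ (ends i) (ends (Suc i)) (separatrix i) (separatrix (Suc i)) \<or>
      elliptic_sector nf (0, 0) circ (ends i) (ends (Suc i)) (separatrix i) (separatrix (Suc i))"
    if "i < 2" for i
    using that hyperbolic_lower elliptic_upper
    by (auto simp: separatrix_def ends_def less_2_cases_iff)
  ultimately show ?thesis
    unfolding sectorial_decomposition_def using jordan_C1_circ by simp
qed

lemma hyperbolic_nf_iff:
  "i < 2 \<and> hyperbolic_sector nf (0, 0) circ (ends i) (ends (Suc i)) (separatrix i) (separatrix (Suc i))
    \<longleftrightarrow> i = 1"
  using hyperbolic_lower upper_not_hyperbolic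
  by (auto simp: separatrix_def ends_def less_2_cases_iff)

lemma elliptic_nf_iff:
  "i < 2 \<and> elliptic_sector nf (0, 0) circ (ends i) (ends (Suc i)) (separatrix i) (separatrix (Suc i))
    \<longleftrightarrow> i = 0"
  using elliptic_upper lower_not_elliptic
  by (auto simp: separatrix_def ends_def less_2_cases_iff)

section \<open>The chart expression\<close>

text \<open>The mixed difference annihilates every monomial not divisible by \<open>x * y\<close>,
  in particular those of degree below 2. On \<open>2 * a * x * y\<close> it equals
  \<open>2 * a\<close>, which shows that the degree of the field is not smaller than 2.\<close>

lemma poly2_degree_le_imp_mixed_difference:
  assumes "poly2_degree_le d f" "d < 2"
  shows "f 1 1 - f 1 0 - f 0 1 + f 0 0 = 0"
proof -
  obtain k where k: "\<And>x y. f x y = (\<Sum>i\<le>d. \<Sum>j\<le>d - i. k i j * x ^ i * y ^ j)"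
    using assms(1) unfolding poly2_degree_le_def by blast
  have "d = 0 \<or> d = 1" using assms(2) by auto
  then show ?thesis by (auto simp: k)
qed

lemma field_degree_xy:
  fixes a :: real
  assumes "a \<noteq> 0"
  shows "field_degree (\<lambda>x y. y) (\<lambda>x y. 2 * a * x * y) = 2"
  unfolding field_degree_def
proof (rule Least_equality)
  have "poly2_degree_le 2 (\<lambda>x y. y)"
    unfolding poly2_degree_le_def
    by (intro exI[of _ "\<lambda>i j. if i = 0 \<and> j = 1 then 1 else 0"]) (simp add: numeral_2_eq_2)
  moreover have "poly2_degree_le 2 (\<lambda>x y. 2 * a * x * y)"
    unfolding poly2_degree_le_def
    by (intro exI[of _ "\<lambda>i j. if i = 1 \<and> j = 1 then 2 * a else 0"]) (simp add: numeral_2_eq_2)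
  ultimately show "poly2_degree_le 2 (\<lambda>x y. y) \<and> poly2_degree_le 2 (\<lambda>x y. 2 * a * x * y)" ..
next
  fix d assume "poly2_degree_le d (\<lambda>x y. y) \<and> poly2_degree_le d (\<lambda>x y. 2 * a * x * y)"
  then show "2 \<le> d"
    using poly2_degree_le_imp_mixed_difference[of d "\<lambda>x y. 2 * a * x * y"] assms by force
qed

text \<open>Off the line \<open>v = 0\<close> the formula simplifies to the polynomial field. On the
  line, the limit is the value of this field by continuity.\<close>

lemma poincare_U2_xy:
  fixes a :: real
  assumes "a \<noteq> 0"
  shows "poincare_U2 (\<lambda>x y. y) (\<lambda>x y. 2 * a * x * y)
           = (\<lambda>(u, v). (v - 2 * a * u\<^sup>2, - 2 * a * u * v))"
proof
  fix z :: "real \<times> real"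
  let ?F = "U2_formula (\<lambda>x y. y) (\<lambda>x y. 2 * a * x * y)"
  let ?G = "\<lambda>z. (snd z - 2 * a * (fst z)\<^sup>2, - 2 * a * fst z * snd z)"
  have FG: "?F w = ?G w" if "snd w \<noteq> 0" for w
    using that unfolding U2_formula_def field_degree_xy[OF assms] Let_def
    by (cases w) (simp add: field_simps power2_eq_square eval_nat_numeral)
  show "poincare_U2 (\<lambda>x y. y) (\<lambda>x y. 2 * a * x * y) z
      = (\<lambda>(u, v). (v - 2 * a * u\<^sup>2, - 2 * a * u * v)) z"
  proof (cases "snd z = 0")
    case False
    then show ?thesis using FG by (simp add: poincare_U2_def case_prod_beta)
  next
    case True
    let ?N = "at z within {w. snd w \<noteq> 0}"
    \<comment> \<open>The filter is nontrivial, since \<open>z\<close> is a limit of points above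
      it; this makes the value of \<open>Lim\<close> the actual limit.\<close>
    have "\<forall>e>0. \<exists>w\<in>{w. snd w \<noteq> 0}. w \<noteq> z \<and> dist w z < e"
    proof (intro allI impI)
      fix e :: real assume "e > 0"
      then show "\<exists>w\<in>{w. snd w \<noteq> 0}. w \<noteq> z \<and> dist w z < e"
        using True by (intro bexI[of _ "(fst z, e / 2)"]) (auto simp: dist_prod_def dist_real_def prod_eq_iff)
    qed
    then have "?N \<noteq> bot"
      by (simp add: trivial_limit_within islimpt_approachable)
    moreover have "(?G \<longlongrightarrow> ?G z) ?N"
      by (intro tendsto_intros)
    then have "(?F \<longlongrightarrow> ?G z) ?N"
      by (rule Lim_transform_eventually) (auto simp: eventually_at_filter FG)
    ultimately have "Lim ?N ?F = ?G z" by (rule tendsto_Lim)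
    then show ?thesis using True by (simp add: poincare_U2_def case_prod_beta)
  qed
qed

section \<open>Rescaling and conclusion\<close>

text \<open>Combines the weighted scaling with weights 1 and 2, which multiplies the field by
  \<kappa>, with the dilation by \<open>1 / (2 * a)\<close>. For negative \<open>a\<close> the
  dilation reverses both axes, but time still runs forwards.\<close>

lemma linear_conjugacy_nf:
  fixes a \<kappa> :: real
  assumes "a \<noteq> 0" "\<kappa> > 0"
  shows "linear_conjugacy (\<lambda>z. (\<kappa> / (2 * a) * fst z, \<kappa>\<^sup>2 / (2 * a) * snd z)) \<kappa> nf
    (\<lambda>(u, v). (v - 2 * a * u\<^sup>2, - 2 * a * u * v))"
proof (rule linear_conjugacy.intro)
  show "linear (\<lambda>z :: real \<times> real. (\<kappa> / (2 * a) * fst z, \<kappa>\<^sup>2 / (2 * a) * snd z))"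
    by (rule linearI) (auto simp: algebra_simps add_divide_distrib)
  show "inj (\<lambda>z :: real \<times> real. (\<kappa> / (2 * a) * fst z, \<kappa>\<^sup>2 / (2 * a) * snd z))"
    using assms by (auto simp: inj_def)
qed (use assms in \<open>auto simp: nf_def field_simps power2_eq_square\<close>)

theorem proposition6p3:
  fixes a :: real
  assumes "a \<noteq> 0"
  shows "poincare_U2 (\<lambda>x y. y) (\<lambda>x y. 2 * a * x * y)
           = (\<lambda>(u, v). (v - 2 * a * u\<^sup>2, - 2 * a * u * v)) \<and>
         has_sectors (\<lambda>(u, v). (v - 2 * a * u\<^sup>2, - 2 * a * u * v)) (0, 0) 1 1"
proof
  show "has_sectors (\<lambda>(u, v). (v - 2 * a * u\<^sup>2, - 2 * a * u * v)) (0, 0) 1 1"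
    unfolding has_sectors_def
  proof (intro allI impI)
    fix \<epsilon> :: real assume "\<epsilon> > 0"
    let ?Y = "\<lambda>(u, v). (v - 2 * a * u\<^sup>2, - 2 * a * u * v)"
    \<comment> \<open>On the disc the coordinates are bounded by 2 and 3, and
      \<open>\<kappa>^2 \<le> \<kappa>\<close> for \<open>\<kappa> \<le> 1\<close>, so the image has
      norm at most \<open>5 * \<kappa> / (2 * \<bar>a\<bar>)\<close>. The second entry of the
      minimum makes this at most \<open>\<epsilon> / 2\<close>.\<close>
    define \<kappa> where "\<kappa> = min 1 (\<bar>a\<bar> * \<epsilon> / 5)"
    have \<kappa>: "0 < \<kappa>" "\<kappa> \<le> 1" "\<kappa> \<le> \<bar>a\<bar> * \<epsilon> / 5"
      using assms \<open>\<epsilon> > 0\<close> by (auto simp: \<kappa>_def)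
    define A where "A = (\<lambda>z :: real \<times> real. (\<kappa> / (2 * a) * fst z, \<kappa>\<^sup>2 / (2 * a) * snd z))"
    interpret linear_conjugacy A \<kappa> nf ?Y
      unfolding A_def using assms \<kappa>(1) by (rule linear_conjugacy_nf)
    have A0: "A (0, 0) = (0, 0)" by (simp add: A_def)
    have "A z \<in> ball (0, 0) \<epsilon>" if "z \<in> disc circ" for z
    proof -
      have "z \<in> cball (0, 1) 2" using that unfolding disc_circ cball_pencil .
      then have "dist (0, 1) z \<le> 2" by (rule mem_cball[THEN iffD1])
      then have "\<bar>fst z\<bar> \<le> 2" "\<bar>snd z - 1\<bar> \<le> 2"
        using dist_fst_le[of "(0, 1)" z] dist_snd_le[of "(0, 1)" z] by (auto simp: dist_real_def)
      then have z: "\<bar>fst z\<bar> \<le> 2" "\<bar>snd z\<bar> \<le> 3" by auto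
      have "norm (A z) \<le> \<bar>\<kappa> / (2 * a) * fst z\<bar> + \<bar>\<kappa>\<^sup>2 / (2 * a) * snd z\<bar>"
        unfolding A_def by (metis norm_Pair_le real_norm_def)
      also have "\<dots> = (\<kappa> * \<bar>fst z\<bar> + \<kappa> * \<kappa> * \<bar>snd z\<bar>) / (2 * \<bar>a\<bar>)"
        using \<kappa>(1) by (simp add: abs_mult power2_eq_square add_divide_distrib)
      also have "\<dots> \<le> (\<kappa> * 2 + \<kappa> * 1 * 3) / (2 * \<bar>a\<bar>)"
        using z \<kappa> by (intro divide_right_mono add_mono mult_mono) auto
      also have "\<dots> = 5 * \<kappa> / (2 * \<bar>a\<bar>)" by simp
      also have "\<dots> \<le> \<bar>a\<bar> * \<epsilon> / (2 * \<bar>a\<bar>)"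
        using \<kappa>(3) by (intro divide_right_mono) auto
      also have "\<dots> < \<epsilon>" using assms \<open>\<epsilon> > 0\<close> by simp
      finally show ?thesis by (simp add: dist_Pair_Pair norm_prod_def flip: zero_prod_def)
    qed
    then have "disc (A \<circ> circ) \<subseteq> ball (0, 0) \<epsilon>" by (auto simp: disc)
    moreover have "sectorial_decomposition ?Y (0, 0) (A \<circ> circ) 2 ends (\<lambda>i t. A (separatrix i (\<kappa> * t)))"
      using sectorial_decomposition[OF sectorial_decomposition_nf] by (simp only: A0)
    moreover note hyperbolic_sector_iff[OF jordan_C1_circ, of "(0, 0)", unfolded A0]
      elliptic_sector_iff[OF jordan_C1_circ, of "(0, 0)", unfolded A0]
    ultimately show "\<exists>\<Gamma> n \<theta> c. sectorial_decomposition ?Y (0, 0) \<Gamma> n \<theta> c \<and> disc \<Gamma> \<subseteq> ball (0, 0) \<epsilon> \<and>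
        card {i. i < n \<and> hyperbolic_sector ?Y (0, 0) \<Gamma> (\<theta> i) (\<theta> (Suc i)) (c i) (c (Suc i))} = 1 \<and>
        card {i. i < n \<and> elliptic_sector ?Y (0, 0) \<Gamma> (\<theta> i) (\<theta> (Suc i)) (c i) (c (Suc i))} = 1"
      by (intro exI[of _ "A \<circ> circ"] exI[of _ 2] exI[of _ ends] exI[of _ "\<lambda>i t. A (separatrix i (\<kappa> * t))"])
         (simp add: hyperbolic_nf_iff elliptic_nf_iff)
  qed
qed (rule poincare_U2_xy[OF assms])

end
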